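(* Assume $E X_1<\infty$, the distribution of $X_1$ is non-lattice and $X_1>0$ a.s., $E V_1^q<\infty$ for every $q>0$, and the CDF $F$ of $V_1$ is continuous. Assume $\rho:=E V_1/E X_1<1$ and the number of servers of the $s$-th loss system is $C_s=s$. Then for every $\delta>0$, $$E_\pi^s|\tau|=o(s^{\delta})\quad\text{as } s\to\infty.$$
   Context: Let $(X_n)_{n\ge1}$ be i.i.d. strictly positive interarrival times with mean $\mu\in(0,\infty)$ and $(V_n)_{n\ge1}$ i.i.d. nonnegative service times with CDF $F$, independent of $(X_n)$. For $s\in\{1,2,\dots\}$ the $s$-th system is the time-stationary GI/GI/$\infty$ queue on $\mathbb R$ whose arrivals form a time-stationary renewal process with interarrival times distributed as $X_1/s$, each customer receiving a service time distributed as $V_1$ (not scaled), beginning service immediately upon arrival. For $t\in\mathbb R$, $y\ge0$, let $Q(t,y)$ be the number of customers present at time $t$ whose residual service time is strictly greater than $y$ (a customer arriving at $t$ is counted at $t$, one departing at $t$ is not), and let $R(t)$ be the maximum residual service time among customers present at time $t$ ($R(t)=0$ if none). Given a number of servers $C_s$, define the coalescence-detection time $$\tau=\sup\{t<0:\ R(t)<|t| \ \text{and}\ Q(u,0)\le C_s \text{ for all } u\in[t,t+R(t)]\}.$$ $E_\pi^s$ denotes expectation for the stationary $s$-th system. *)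

theory Defs
  imports "HOL-Probability.Probability"
begin

datatype src = Gap int | Serv int | LenB | Unif

definition srcvar :: "(int \<Rightarrow> 'a \<Rightarrow> real) \<Rightarrow> (int \<Rightarrow> 'a \<Rightarrow> real) \<Rightarrow> ('a \<Rightarrow> real) \<Rightarrow> ('a \<Rightarrow> real)
    \<Rightarrow> src \<Rightarrow> 'a \<Rightarrow> real" where
  "srcvar X V L U i = (case i of Gap k \<Rightarrow> X k | Serv k \<Rightarrow> V k | LenB \<Rightarrow> L | Unif \<Rightarrow> U)"

definition nonlattice :: "real measure \<Rightarrow> bool" where
  "nonlattice D \<longleftrightarrow> \<not> (\<exists>d>0. AE x in D. \<exists>n::int. x = d * of_int n)"

text \<open>Arrival times of the time-stationary renewal process of the s-th system:
  A 0 \<le> 0 < A 1 are the endpoints of the length-biased interval of length l/s straddling 0,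
  with 0 at relative position u inside it; the other gaps are g k / s.\<close>
definition arr :: "real \<Rightarrow> (int \<Rightarrow> real) \<Rightarrow> real \<Rightarrow> real \<Rightarrow> int \<Rightarrow> real" where
  "arr s g l u k =
     (if k \<ge> 1 then u * l / s + (\<Sum>j\<in>{1..<k}. g j) / s
      else - (1 - u) * l / s - (\<Sum>j\<in>{k..-1}. g j) / s)"

text \<open>Q(t,y): number of customers present at t with residual service time > y.\<close>
definition Qf :: "(int \<Rightarrow> real) \<Rightarrow> (int \<Rightarrow> real) \<Rightarrow> real \<Rightarrow> real \<Rightarrow> nat" where
  "Qf A W t y = card {k. A k \<le> t \<and> A k + W k - t > y}"

text \<open>R(t): maximal residual service time among customers present at t (0 if none).\<close>
definition Rf :: "(int \<Rightarrow> real) \<Rightarrow> (int \<Rightarrow> real) \<Rightarrow> real \<Rightarrow> ereal" where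
  "Rf A W t = Sup ({ereal (A k + W k - t) | k. A k \<le> t \<and> t < A k + W k} \<union> {0})"

text \<open>Coalescence-detection time with C servers (supremum of the empty set is -\<infinity>).\<close>
definition tauf :: "(int \<Rightarrow> real) \<Rightarrow> (int \<Rightarrow> real) \<Rightarrow> nat \<Rightarrow> ereal" where
  "tauf A W C = Sup {ereal t | t. t < 0 \<and> Rf A W t < ereal \<bar>t\<bar> \<and>
      (\<forall>u. ereal t \<le> ereal u \<and> ereal u \<le> ereal t + Rf A W t \<longrightarrow> Qf A W u 0 \<le> C)}"

end

theory Submission
  imports Defs
begin

text \<open>Look for a coalescence certificate at past arrival epochs. At such an epoch the maximal residual
  service time is short and the next few arrivals never see more than \<open>s\<close> customers, up to events whose
  probability is small by Chernoff bounds, since interarrival times are positive and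
  \<open>E V\<close> is smaller than \<open>E X\<close>. With \<open>K\<close> of order \<open>s powr (1 + d)\<close> for some \<open>d < \<delta>\<close>, an attempt that only inspects \<open>B\<close>
  arrivals on either side, \<open>B \<ge> K\<close>, fails with probability at most \<open>1/4\<close>. At level \<open>i\<close> one makes \<open>i + 1\<close> attempts
  in disjoint, hence independent, blocks of length of order \<open>B = 2\<^sup>i K\<close>; they all fail with
  probability at most \<open>4\<^sup>-\<^sup>i\<close>, whereas the level reaches back in time only by order \<open>i 2\<^sup>i K / s\<close>. Influence of
  customers more than \<open>B\<close> arrivals back is negligible by the moment assumption. Summing over the levels gives
  \<open>E |\<tau>| = O(K / s)\<close>.

  The length-biased interval around \<open>0\<close> may have infinite mean. If it is longer than the residual
  service time at its left end then \<open>\<tau> = 0\<close>, so it never contributes more than that residual time.\<close>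

text \<open>The gaps have only a first moment, and elapsed time must be integrated over failure
  events that depend on the same gaps, so independence alone does not separate the two. Therefore
  failure events are measured with a weight for each single gap. Only short sums of gaps are
  harmful, and for nonnegative variables these are exponentially unlikely without any exponential
  moment.

  Longer blocks alone would not help: the chance that an attempt sees more than \<open>s\<close>
  customers is controlled through \<open>s\<close> only and does not shrink as \<open>B\<close>
  grows. Hence the repeated attempts, whose factor 1/4 each beats the doubling of the block length.

  A slope \<open>c\<close> with \<open>E V < c < E X\<close> decouples the two sequences: a customer
  \<open>k\<close> arrivals back has left once its service time is at most \<open>c * k / s\<close>
  while the \<open>k\<close> gaps in between sum to more than \<open>c * k\<close>. The scale of
  \<open>K\<close> makes \<open>K / s\<close> at least a fixed positive power of \<open>K\<close>,
  so that high moments of \<open>V\<close> give any polynomial decay in \<open>K\<close>.\<close>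

definition window :: "(nat \<Rightarrow> real) \<Rightarrow> nat \<Rightarrow> nat \<Rightarrow> real" where
  "window y h k = (\<Sum>j\<in>{h..<h + k}. y j)"

text \<open>Customers are numbered backwards in time: \<open>w l\<close> is the service time of customer \<open>l\<close>, who arrives
  \<open>y l / s\<close> after customer \<open>l + 1\<close>, and \<open>window y h k / s\<close> is the time between the arrivals of \<open>h + k\<close> and \<open>h\<close>.
  The time of the attempt is the arrival of customer \<open>n\<close>. Lags \<open>k \<ge> B\<close> are left to \<open>tail_ok\<close>, so that the
  attempt depends only on the indices in \<open>{n - K..<n + B}\<close>.\<close>
definition attempt_ok ::
    "real \<Rightarrow> nat \<Rightarrow> nat \<Rightarrow> nat \<Rightarrow> nat \<Rightarrow> (nat \<Rightarrow> real) \<Rightarrow> (nat \<Rightarrow> real) \<Rightarrow> bool" where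
  "attempt_ok c s K B n y w \<longleftrightarrow>
     (\<forall>l\<in>{n - K<..<n + K}. w l \<le> c * K / s) \<and>
     c * K < window y (n - K) K \<and>
     (\<forall>h\<in>{n - K<..n}. (\<Sum>k<K. of_bool (w (h + k) > window y h k / s)) \<le> real s) \<and>
     (\<forall>h\<in>{n - K<..n}. \<forall>k\<in>{K..<B}. w (h + k) \<le> c * k / s \<and> c * k < window y h k)"

definition tail_ok ::
    "real \<Rightarrow> nat \<Rightarrow> nat \<Rightarrow> nat \<Rightarrow> (nat \<Rightarrow> real) \<Rightarrow> (nat \<Rightarrow> real) \<Rightarrow> bool" where
  "tail_ok c s B N y w \<longleftrightarrow>
     (\<forall>l<B. w l \<le> c * B / s) \<and>
     (\<forall>h\<le>N. \<forall>k\<ge>B. w (h + k) \<le> c * k / s \<and> c * k < window y h k)"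

section \<open>Pathwise bounds on the coalescence time\<close>

lemma window_diff: "window y h k = sum y {..<h + k} - sum y {..<h}"
proof -
  have "{..<h + k} = {..<h} \<union> {h..<h + k}" by auto
  hence "sum y {..<h + k} = sum y {..<h} + sum y {h..<h + k}"
    by (simp add: sum.union_disjoint ivl_disj_int)
  thus ?thesis by (simp add: window_def)
qed

text \<open>One sample path seen backwards from time 0. Customer 0 arrives at \<open>- D\<close>, so
  \<open>D\<close> is the age at 0 of the straddling interval. Later arrivals enter only through
  their sign, because the times inspected are all negative.\<close>

locale past =
  fixes A V :: "int \<Rightarrow> real" and y w :: "nat \<Rightarrow> real" and D :: real and s :: nat
  assumes s: "s \<ge> 1" and y: "\<And>j. y j \<ge> 0" and w: "\<And>j. w j \<ge> 0" and D: "D \<ge> 0"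
    and A_past: "\<And>n. A (- int n) = - D - sum y {..<n} / s"
    and A_future: "\<And>k. k \<ge> 1 \<Longrightarrow> A k \<ge> 0"
    and V_past: "\<And>n. V (- int n) = w n"
begin

lemma past_cases:
  assumes "A k < 0"
  obtains l where "k = - int l"
proof -
  have "\<not> k \<ge> 1" using A_future[of k] assms by auto
  hence "k = - int (nat (- k))" by simp
  thus ?thesis by (rule that)
qed

lemma sum_mono_idx: "m \<le> n \<Longrightarrow> sum y {..<m} \<le> sum y {..<n}"
  by (rule sum_mono2) (auto simp: y)

lemma tauf_nonpos: "tauf A V s \<le> 0"
  unfolding tauf_def by (rule Sup_least) auto

text \<open>On these events the residual service time at the arrival of \<open>n\<close> is at most \<open>c K / s\<close>, and no
  customer of index \<open>n - K\<close> or less arrives during that time; the queue length only rises at arrivals, so it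
  suffices to count at the arrivals of \<open>h\<in>{n - K<..n}\<close>.\<close>
lemma tauf_ge:
  assumes K: "1 \<le> K" "K \<le> B" "K \<le> n" "n \<le> N" and c: "c > 0"
    and ok: "attempt_ok c s K B n y w" and tail: "tail_ok c s B N y w"
  shows "ereal (- D - sum y {..<n} / s) \<le> tauf A V s"
proof -
  define T where "T = c * K / s"
  define S where "S m = sum y {..<m} / s" for m
  define t where "t = - D - S n"
  have s0: "real s > 0" using s by simp
  have win: "window y h k / s = S (h + k) - S h" for h k
    by (simp add: window_diff S_def diff_divide_distrib)
  have S0: "S m \<ge> 0" for m unfolding S_def using y by (simp add: sum_nonneg)
  have A': "A (- int l) = - D - S l" for l by (simp add: A_past S_def)
  have T0: "T > 0" unfolding T_def using c K s0 by simp
  have wT: "w l \<le> T" if "n - K < l" "l < n + K" for l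
    using ok that by (auto simp: attempt_ok_def T_def)
  have ST: "T < S n - S (n - K)"
  proof -
    have "c * K < window y (n - K) K" using ok by (simp add: attempt_ok_def)
    hence "c * K / s < window y (n - K) K / s" using s0 by (simp add: divide_strict_right_mono)
    thus ?thesis using K by (simp add: win T_def)
  qed
  \<comment> \<open>From lag \<open>K\<close> on, both sides are compared with the line
    \<open>c * k / s\<close>: for lags below \<open>B\<close> by the attempt, for the others by
    \<open>tail_ok\<close>, which applies because \<open>h \<le> n \<le> N\<close>.\<close>
  have far: "w (h + k) \<le> S (h + k) - S h" if "n - K < h" "h \<le> n" "k \<ge> K" for h k
  proof -
    have *: "w (h + k) \<le> c * k / s \<and> c * k < window y h k"
    proof (cases "k < B")
      case True thus ?thesis using ok that by (auto simp: attempt_ok_def)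
    next
      case False thus ?thesis using tail that K by (auto simp: tail_ok_def)
    qed
    hence "c * k / s \<le> window y h k / s" using s0 by (simp add: divide_right_mono)
    thus ?thesis using * win[of h k] by linarith
  qed
  have t0: "t < 0" using ST T0 S0[of "n - K"] D unfolding t_def by linarith
  \<comment> \<open>\<open>t + (S n - S (n - K))\<close> is the arrival time of customer
    \<open>n - K\<close>; whoever arrives before it has a larger index.\<close>
  have idx: "l > n - K" if "A (- int l) < t + (S n - S (n - K))" for l
  proof (rule ccontr)
    assume "\<not> l > n - K"
    hence "S l \<le> S (n - K)" unfolding S_def using sum_mono_idx[of l "n - K"] s0
      by (simp add: divide_right_mono)
    thus False using that by (simp add: A' t_def)
  qed
  have R: "Rf A V t \<le> ereal T"
    unfolding Rf_def
  proof (rule Sup_least)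
    fix x assume "x \<in> {ereal (A k + V k - t) |k. A k \<le> t \<and> t < A k + V k} \<union> {0}"
    then consider "x = 0" | k where "x = ereal (A k + V k - t)" "A k \<le> t" "t < A k + V k" by auto
    thus "x \<le> ereal T"
    proof cases
      case 1 thus ?thesis using T0 by simp
    next
      case 2
      obtain l where l: "k = - int l" using past_cases[of k] 2 t0 by auto
      have l1: "l > n - K" using idx[of l] 2 ST T0 l by auto
      have "A k + V k - t \<le> T"
      proof (cases "l < n + K")
        case True
        thus ?thesis using wT[of l] l1 2(2) l V_past[of l] by auto
      next
        case False
        hence "w l \<le> S l - S n" using far[of n "l - n"] K by auto
        thus ?thesis using T0 l by (simp add: A' V_past t_def)
      qed
      thus ?thesis using 2 by simp
    qed
  qed
  have R1: "Rf A V t < ereal \<bar>t\<bar>"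
  proof -
    have "T < \<bar>t\<bar>" using ST S0[of "n - K"] D t0 unfolding t_def by linarith
    thus ?thesis using R by (meson ereal_less_eq(3) le_less_trans less_ereal.simps(1))
  qed
  have Q: "Qf A V u 0 \<le> s" if u: "ereal t \<le> ereal u" "ereal u \<le> ereal t + Rf A V t" for u
  proof -
    have "ereal u \<le> ereal t + ereal T"
      using u(2) R by (meson add_left_mono order_trans)
    hence ut: "t \<le> u" "u \<le> t + T" using u by auto
    have u0: "u < 0"
      using ut ST S0[of "n - K"] D unfolding t_def by linarith
    \<comment> \<open>Indices run backwards, so the least index is the latest arrival not after
      \<open>u\<close>. Residual service times at \<open>u\<close> are no larger than at that
      arrival.\<close>
    define h where "h = (LEAST l. A (- int l) \<le> u)"
    have h1: "A (- int h) \<le> u"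
      unfolding h_def by (rule LeastI[of _ n]) (use ut in \<open>simp add: A' t_def\<close>)
    have hmin: "h \<le> l" if "A (- int l) \<le> u" for l
      unfolding h_def using that by (rule Least_le)
    have hn: "h \<le> n" using hmin[of n] ut by (simp add: A' t_def)
    have hK: "h > n - K" using idx[of h] h1 ut ST by linarith
    have sub: "{k. A k \<le> u \<and> A k + V k - u > 0} \<subseteq>
        (\<lambda>k. - int (h + k)) ` {k\<in>{..<K}. w (h + k) > window y h k / s}"
    proof
      fix k assume "k \<in> {k. A k \<le> u \<and> A k + V k - u > 0}"
      hence k: "A k \<le> u" "A k + V k > u" by auto
      obtain l where l: "k = - int l" using past_cases[of k] k u0 by auto
      have hl: "h \<le> l" using hmin k l by simp
      have "w l > S l - S h" using k(2) h1 l by (simp add: A' V_past)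
      hence w: "w (h + (l - h)) > window y h (l - h) / s" using hl by (simp add: win)
      have "l - h < K" using far[of h "l - h"] hK hn w hl by (force simp: win)
      thus "k \<in> (\<lambda>k. - int (h + k)) ` {k\<in>{..<K}. w (h + k) > window y h k / s}"
        using w hl l by (intro image_eqI[of _ _ "l - h"]) auto
    qed
    have "Qf A V u 0 \<le> card ((\<lambda>k. - int (h + k)) ` {k\<in>{..<K}. w (h + k) > window y h k / s})"
      unfolding Qf_def using sub by (intro card_mono) auto
    also have "\<dots> \<le> card {k\<in>{..<K}. w (h + k) > window y h k / s}"
      by (intro card_image_le) auto
    also have "real \<dots> = (\<Sum>k<K. of_bool (w (h + k) > window y h k / s))"
      by (simp add: sum.If_cases of_bool_def Int_def)
    also have "\<dots> \<le> real s" using ok hK hn by (auto simp: attempt_ok_def)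
    finally show ?thesis by simp
  qed
  have "ereal t \<le> tauf A V s"
    unfolding tauf_def by (rule Sup_upper) (use t0 R1 Q in blast)
  thus ?thesis by (simp add: t_def S_def)
qed

text \<open>By \<open>res\<close>, everyone who arrived by \<open>- D\<close> has left by
  \<open>T - D\<close>, and nobody else arrives before 0. Hence the system is empty throughout
  \<open>(T - D, 0)\<close>, every time in it qualifies with \<open>R = 0\<close>, and such times
  approach 0.\<close>

lemma tauf_zero:
  assumes T: "T < D" and res: "\<And>l. w l \<le> sum y {..<l} / s + T"
  shows "tauf A V s = 0"
proof (rule antisym[OF tauf_nonpos])
  have T0: "T \<ge> 0" using res[of 0] w[of 0] by simp
  have none: "\<not> (A k \<le> t \<and> t < A k + V k)" if t: "t < 0" "T - D < t" for t k
  proof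
    assume k: "A k \<le> t \<and> t < A k + V k"
    then obtain l where l: "k = - int l" using past_cases[of k] t by auto
    show False using res[of l] k t l by (simp add: A_past V_past)
  qed
  have "ereal t \<le> tauf A V s" if t: "t < 0" "T - D < t" for t
    unfolding tauf_def
  proof (rule Sup_upper, intro CollectI exI conjI allI impI)
    have "{ereal (A k + V k - t) |k. A k \<le> t \<and> t < A k + V k} = {}" using none[OF t] by blast
    hence R: "Rf A V t = 0" unfolding Rf_def by (simp only: Un_empty_left) simp
    show "Rf A V t < ereal \<bar>t\<bar>" using R t by simp
    fix u assume "ereal t \<le> ereal u \<and> ereal u \<le> ereal t + Rf A V t"
    hence "u = t" using R by auto
    moreover have "{k. A k \<le> t \<and> A k + V k - t > 0} = {}" using none[OF t] by auto
    ultimately show "Qf A V u 0 \<le> s" unfolding Qf_def by (simp only: card.empty)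
  qed (use t in auto)
  hence *: "ereal t \<le> tauf A V s" if "max (T - D) (-1) < t" "t < 0" for t using that by auto
  show "0 \<le> tauf A V s"
  proof (rule dense_le_bounded[of "ereal (max (T - D) (-1))"])
    show "ereal (max (T - D) (-1)) < 0" using T by simp
  next
    fix x assume "ereal (max (T - D) (-1)) < x" "x < 0"
    thus "x \<le> tauf A V s" using * by (cases x) auto
  qed
qed

text \<open>The bound must be free of \<open>D\<close>. \<open>tail_ok\<close> limits all residual
  service times at the arrival of customer 0 to \<open>c * B / s\<close>: directly for
  \<open>l < B\<close>, and for older customers because they have already left. If \<open>D\<close>
  exceeds this, \<open>tauf_zero\<close> applies; otherwise \<open>D\<close> is itself at most
  \<open>c * B / s\<close> and \<open>tauf_ge\<close> suffices.\<close>

lemma abs_tauf_le: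
  assumes K: "1 \<le> K" "K \<le> B" "K \<le> n" "n \<le> N" and c: "c > 0"
    and ok: "attempt_ok c s K B n y w" and tail: "tail_ok c s B N y w"
  shows "\<bar>tauf A V s\<bar> \<le> ereal (c * B / s + sum y {..<N} / s)"
proof (cases "c * B / s < D")
  case True
  have s0: "real s > 0" using s by simp
  have "w l \<le> sum y {..<l} / s + c * B / s" for l
  proof (cases "l < B")
    case True
    have "0 \<le> sum y {..<l} / s" using y by (simp add: sum_nonneg)
    thus ?thesis using tail True by (auto simp: tail_ok_def intro: add_increasing)
  next
    case False
    hence 1: "w l \<le> c * l / s" "c * l < window y 0 l" using tail by (auto simp: tail_ok_def)
    hence "w l \<le> sum y {..<l} / s"
      using s0 by (simp add: window_diff field_simps)
    thus ?thesis using c by (simp add: add_increasing2)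
  qed
  hence "tauf A V s = 0" by (rule tauf_zero[OF True])
  thus ?thesis using c y by (simp add: sum_nonneg)
next
  case False
  have "sum y {..<n} / s \<le> sum y {..<N} / s" using sum_mono_idx K by (simp add: divide_right_mono)
  hence "ereal (- (c * B / s + sum y {..<N} / s)) \<le> ereal (- D - sum y {..<n} / s)"
    using False by simp
  also have "\<dots> \<le> tauf A V s" by (rule tauf_ge[OF assms])
  finally show ?thesis using tauf_nonpos
    by (cases "tauf A V s") (auto simp: abs_if)
qed

end

section \<open>Independence and the weighted size of failure events\<close>

text \<open>Restrictions to disjoint index sets are independent, but live on different product
  spaces. \<open>e j\<close> extends them by 0 to all indices, and by \<open>dep\<close> this does
  not change \<open>g j\<close>. So events can be stated on the full sequence, with only a set of
  relevant indices to be tracked.\<close>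

lemma (in prob_space) nn_integral_prod_disjoint_coordinates:
  assumes ind: "indep_vars (\<lambda>_. borel) Z (UNIV :: 'i set)" and J: "finite J"
    and K: "disjoint_family_on K J"
    and g: "\<And>j. j \<in> J \<Longrightarrow> g j \<in> borel_measurable (PiM UNIV (\<lambda>_. borel))"
    and dep: "\<And>j f f'. j \<in> J \<Longrightarrow> (\<And>i. i \<in> K j \<Longrightarrow> f i = f' i) \<Longrightarrow> g j f = (g j f' :: ennreal)"
  shows "(\<integral>\<^sup>+\<omega>. (\<Prod>j\<in>J. g j (\<lambda>i. Z i \<omega> :: real)) \<partial>M) = (\<Prod>j\<in>J. \<integral>\<^sup>+\<omega>. g j (\<lambda>i. Z i \<omega>) \<partial>M)"
proof -
  define e where "e j f = (\<lambda>i. if i \<in> K j then f i else 0 :: real)" for j and f :: "'i \<Rightarrow> real"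
  have e: "e j \<in> measurable (PiM (K j) (\<lambda>_. borel)) (PiM UNIV (\<lambda>_. borel))" for j
  proof (rule measurable_PiM_single')
    fix i show "(\<lambda>f. e j f i) \<in> borel_measurable (PiM (K j) (\<lambda>_. borel))"
      by (cases "i \<in> K j") (auto simp: e_def)
  qed auto
  have "indep_vars (\<lambda>j. PiM (K j) (\<lambda>_. borel)) (\<lambda>j \<omega>. restrict (\<lambda>i. Z i \<omega>) (K j)) J"
    by (rule indep_vars_restrict[OF ind _ K]) auto
  hence ind': "indep_vars (\<lambda>_. borel) (\<lambda>j \<omega>. g j (e j (restrict (\<lambda>i. Z i \<omega>) (K j)))) J"
    by (rule indep_vars_compose2) (rule measurable_compose[OF e g])
  have "g j (e j (restrict (\<lambda>i. Z i \<omega>) (K j))) = g j (\<lambda>i. Z i \<omega>)" if "j \<in> J" for j \<omega>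
    by (rule dep[OF that]) (simp add: e_def)
  hence "(\<integral>\<^sup>+\<omega>. (\<Prod>j\<in>J. g j (\<lambda>i. Z i \<omega>)) \<partial>M)
      = (\<integral>\<^sup>+\<omega>. (\<Prod>j\<in>J. g j (e j (restrict (\<lambda>i. Z i \<omega>) (K j)))) \<partial>M)"
    and "(\<Prod>j\<in>J. \<integral>\<^sup>+\<omega>. g j (\<lambda>i. Z i \<omega>) \<partial>M)
      = (\<Prod>j\<in>J. \<integral>\<^sup>+\<omega>. g j (e j (restrict (\<lambda>i. Z i \<omega>) (K j))) \<partial>M)"
    by (auto intro!: nn_integral_cong prod.cong)
  thus ?thesis using indep_vars_nn_integral[OF J ind'] by simp
qed

text \<open>Joint independence of both sequences is expressed by one family over
  \<open>nat + nat\<close>. Signs hold everywhere and not just almost surely; clipping at 0 provides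
  this when the locale is instantiated. In \<open>stable\<close> the speed-up of arrivals by
  \<open>s\<close> has cancelled against the \<open>s\<close> servers.\<close>

locale iid_queue = prob_space M for M :: "'a measure" +
  fixes Y W :: "nat \<Rightarrow> 'a \<Rightarrow> real"
  assumes indep: "indep_vars (\<lambda>_. borel) (case_sum Y W) UNIV"
    and Y_distr: "\<And>j. distr M borel (Y j) = distr M borel (Y 0)"
    and W_distr: "\<And>j. distr M borel (W j) = distr M borel (W 0)"
    and Y_nonneg: "\<And>j \<omega>. Y j \<omega> \<ge> 0" and W_nonneg: "\<And>j \<omega>. W j \<omega> \<ge> 0"
    and Y_int: "integrable M (Y 0)"
    and W_int: "\<And>q. q > 0 \<Longrightarrow> integrable M (\<lambda>\<omega>. W 0 \<omega> powr q)"
    and stable: "expectation (W 0) < expectation (Y 0)"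
begin

lemma case_sum_meas: "case_sum Y W i \<in> borel_measurable M"
  using indep by (auto simp: indep_vars_def)

lemma Y_meas[measurable]: "Y j \<in> borel_measurable M"
  using case_sum_meas[of "Inl j"] by simp

lemma W_meas[measurable]: "W j \<in> borel_measurable M"
  using case_sum_meas[of "Inr j"] by simp

lemma nn_integral_Y: "f \<in> borel_measurable borel \<Longrightarrow> (\<integral>\<^sup>+\<omega>. f (Y j \<omega>) \<partial>M) = (\<integral>\<^sup>+\<omega>. f (Y 0 \<omega>) \<partial>M)"
  using nn_integral_distr[of "Y j" M borel f] nn_integral_distr[of "Y 0" M borel f] Y_distr[of j] by simp

lemma nn_integral_W: "f \<in> borel_measurable borel \<Longrightarrow> (\<integral>\<^sup>+\<omega>. f (W j \<omega>) \<partial>M) = (\<integral>\<^sup>+\<omega>. f (W 0 \<omega>) \<partial>M)"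
  using nn_integral_distr[of "W j" M borel f] nn_integral_distr[of "W 0" M borel f] W_distr[of j] by simp

abbreviation "\<mu> \<equiv> expectation (Y 0)"
abbreviation "\<nu> \<equiv> expectation (W 0)"

lemma W_integrable: "integrable M (W 0)"
  using W_int[of 1] W_nonneg by (simp add: powr_one)

lemma \<nu>_nonneg: "\<nu> \<ge> 0" by (intro integral_nonneg_AE AE_I2 W_nonneg)
lemma \<mu>_pos: "\<mu> > 0" using \<nu>_nonneg stable by simp

lemma nn_expectation_Y: "(\<integral>\<^sup>+\<omega>. ennreal (Y j \<omega>) \<partial>M) = ennreal \<mu>"
  using nn_integral_Y[of ennreal j] by (simp add: nn_integral_eq_integral[OF Y_int] Y_nonneg)

definition Z :: "'a \<Rightarrow> nat + nat \<Rightarrow> real" where "Z \<omega> i = case_sum Y W i \<omega>"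

lemma Z_simps[simp]: "Z \<omega> (Inl j) = Y j \<omega>" "Z \<omega> (Inr j) = W j \<omega>" by (auto simp: Z_def)

lemma Z_meas[measurable]: "Z \<in> measurable M (PiM UNIV (\<lambda>_. borel))"
proof (rule measurable_PiM_single')
  fix i show "(\<lambda>\<omega>. Z \<omega> i) \<in> borel_measurable M" unfolding Z_def using case_sum_meas .
qed auto

lemma nn_integral_prod_Z:
  assumes "finite J" "disjoint_family_on K J"
    and "\<And>j. j \<in> J \<Longrightarrow> g j \<in> borel_measurable (PiM UNIV (\<lambda>_. borel))"
    and "\<And>j f f'. j \<in> J \<Longrightarrow> (\<And>i. i \<in> K j \<Longrightarrow> f i = f' i) \<Longrightarrow> g j f = (g j f' :: ennreal)"
  shows "(\<integral>\<^sup>+\<omega>. (\<Prod>j\<in>J. g j (Z \<omega>)) \<partial>M) = (\<Prod>j\<in>J. \<integral>\<^sup>+\<omega>. g j (Z \<omega>) \<partial>M)"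
proof -
  have "Z \<omega> = (\<lambda>i. case_sum Y W i \<omega>)" for \<omega> by (auto simp: Z_def)
  thus ?thesis using nn_integral_prod_disjoint_coordinates[OF indep assms] by simp
qed

lemma nn_integral_mult_Z:
  assumes "A \<inter> B = {}"
    and "f \<in> borel_measurable (PiM UNIV (\<lambda>_. borel))" "g \<in> borel_measurable (PiM UNIV (\<lambda>_. borel))"
    and "\<And>x x'. (\<And>i. i \<in> A \<Longrightarrow> x i = x' i) \<Longrightarrow> f x = (f x' :: ennreal)"
    and "\<And>x x'. (\<And>i. i \<in> B \<Longrightarrow> x i = x' i) \<Longrightarrow> g x = (g x' :: ennreal)"
  shows "(\<integral>\<^sup>+\<omega>. f (Z \<omega>) * g (Z \<omega>) \<partial>M) = (\<integral>\<^sup>+\<omega>. f (Z \<omega>) \<partial>M) * (\<integral>\<^sup>+\<omega>. g (Z \<omega>) \<partial>M)"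
proof -
  define G where "G j = (if j then f else g)" for j :: bool
  have "(\<integral>\<^sup>+\<omega>. (\<Prod>j\<in>UNIV. G j (Z \<omega>)) \<partial>M) = (\<Prod>j\<in>UNIV. \<integral>\<^sup>+\<omega>. G j (Z \<omega>) \<partial>M)"
  proof (rule nn_integral_prod_Z[where g = G and K = "\<lambda>j. if j then A else B"])
    fix j x x' assume "\<And>i. i \<in> (if j then A else B) \<Longrightarrow> x i = (x' i :: real)"
    thus "G j x = G j x'" using assms(4,5)[of x x'] by (auto simp: G_def split: if_splits)
  qed (use assms(1-3) in \<open>auto simp: disjoint_family_on_def G_def\<close>)
  moreover have "(\<Prod>j\<in>UNIV. h j) = h True * h False" for h :: "bool \<Rightarrow> ennreal"
    by (simp add: UNIV_bool mult.commute)
  ultimately show ?thesis by (simp add: G_def)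
qed

text \<open>The factor $1 + Y_j$ lets one bound cover both the probability of an event and
  the mean of an interarrival time on it, although $Y_j$ has only a first moment.\<close>
definition small :: "'a set \<Rightarrow> ennreal \<Rightarrow> bool" where
  "small A q \<longleftrightarrow> A \<in> events \<and> (\<forall>j. (\<integral>\<^sup>+\<omega>. (1 + ennreal (Y j \<omega>)) * indicator A \<omega> \<partial>M) \<le> q)"

lemma smallD: "small A q \<Longrightarrow> A \<in> events"
  by (simp add: small_def)

lemma small_mono: "small A q \<Longrightarrow> q \<le> r \<Longrightarrow> small A r"
  by (auto simp: small_def intro: order_trans)

lemma small_subset:
  assumes "small A q" "B \<subseteq> A" "B \<in> events"
  shows "small B q"
  unfolding small_def
proof (intro conjI allI)
  fix j
  have "(\<integral>\<^sup>+\<omega>. (1 + ennreal (Y j \<omega>)) * indicator B \<omega> \<partial>M) \<le> (\<integral>\<^sup>+\<omega>. (1 + ennreal (Y j \<omega>)) * indicator A \<omega> \<partial>M)"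
    using assms(2) by (intro nn_integral_mono mult_left_mono) (auto split: split_indicator)
  also have "\<dots> \<le> q" using assms(1) by (simp add: small_def)
  finally show "(\<integral>\<^sup>+\<omega>. (1 + ennreal (Y j \<omega>)) * indicator B \<omega> \<partial>M) \<le> q" .
qed (rule assms)

lemma small_Union:
  assumes "\<And>i::nat. small (A i) (q i)"
  shows "small (\<Union>i. A i) (\<Sum>i. q i)"
  unfolding small_def
proof (intro conjI allI)
  have [measurable]: "A i \<in> events" for i using assms by (simp add: small_def)
  show "(\<Union>i. A i) \<in> events" by measurable
  fix j
  have "(\<integral>\<^sup>+\<omega>. (1 + ennreal (Y j \<omega>)) * indicator (\<Union>i. A i) \<omega> \<partial>M)
      \<le> (\<integral>\<^sup>+\<omega>. (\<Sum>i. (1 + ennreal (Y j \<omega>)) * indicator (A i) \<omega>) \<partial>M)"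
  proof (intro nn_integral_mono)
    fix \<omega>
    have "indicator (\<Union>i. A i) \<omega> \<le> (\<Sum>i. indicator (A i) \<omega> :: ennreal)"
    proof (cases "\<omega> \<in> (\<Union>i. A i)")
      case True
      then obtain i where "\<omega> \<in> A i" by auto
      hence "indicator (\<Union>i. A i) \<omega> \<le> (\<Sum>i\<in>{i}. indicator (A i) \<omega> :: ennreal)"
        by (simp split: split_indicator)
      also have "\<dots> \<le> (\<Sum>i. indicator (A i) \<omega>)" by (rule sum_le_suminf) auto
      finally show ?thesis .
    qed auto
    thus "(1 + ennreal (Y j \<omega>)) * indicator (\<Union>i. A i) \<omega> \<le> (\<Sum>i. (1 + ennreal (Y j \<omega>)) * indicator (A i) \<omega>)"
      by (simp add: mult_left_mono)
  qed
  also have "\<dots> = (\<Sum>i. \<integral>\<^sup>+\<omega>. (1 + ennreal (Y j \<omega>)) * indicator (A i) \<omega> \<partial>M)"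
    by (rule nn_integral_suminf) measurable
  also have "\<dots> \<le> (\<Sum>i. q i)"
    using assms by (intro suminf_le) (auto simp: small_def)
  finally show "(\<integral>\<^sup>+\<omega>. (1 + ennreal (Y j \<omega>)) * indicator (\<Union>i. A i) \<omega> \<partial>M) \<le> (\<Sum>i. q i)" .
qed

lemma small_empty: "small {} 0" by (simp add: small_def)

lemma small_UN_finite:
  assumes "finite I" "\<And>i. i \<in> I \<Longrightarrow> small (A i) (q i)"
  shows "small (\<Union>i\<in>I. A i) (\<Sum>i\<in>I. q i)"
  using assms
proof (induction I rule: finite_induct)
  case (insert x I)
  define A' where "A' n = (if n = 0 then A x else if n = 1 then \<Union> (A ` I) else {})" for n :: nat
  define q' where "q' n = (if n = 0 then q x else if n = 1 then sum q I else 0)" for n :: nat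
  have "small (\<Union>n. A' n) (\<Sum>n. q' n)"
    by (rule small_Union) (use insert in \<open>auto simp: A'_def q'_def small_empty\<close>)
  also have "(\<Union>n. A' n) = A x \<union> \<Union> (A ` I)"
    by (auto simp: A'_def split: if_splits intro: exI[of _ 0] exI[of _ 1])
  also have "(\<Sum>n. q' n) = (\<Sum>n\<in>{0, 1}. q' n)"
    by (rule suminf_finite) (auto simp: q'_def)
  finally show ?case using insert by (simp add: q'_def)
qed (simp add: small_empty)

lemma small_Un: "small A q \<Longrightarrow> small B r \<Longrightarrow> small (A \<union> B) (q + r)"
  using small_UN_finite[of "{True, False}" "\<lambda>b. if b then A else B" "\<lambda>b. if b then q else r"]
  by (auto simp: Un_commute)

lemma small_emeasure:
  assumes "small A q"
  shows "emeasure M A \<le> q"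
proof -
  have "emeasure M A = (\<integral>\<^sup>+\<omega>. indicator A \<omega> \<partial>M)" using assms by (simp add: small_def)
  also have "\<dots> \<le> (\<integral>\<^sup>+\<omega>. (1 + ennreal (Y 0 \<omega>)) * indicator A \<omega> \<partial>M)"
    by (intro nn_integral_mono) (auto split: split_indicator)
  also have "\<dots> \<le> q" using assms by (simp add: small_def)
  finally show ?thesis .
qed

text \<open>By linearity each gap contributes its own integral over \<open>A\<close>, which the
  weight in \<open>small\<close> already bounds by \<open>q\<close>. This is how elapsed time is
  integrated over an event that may depend on all the gaps involved.\<close>

lemma small_integral:
  assumes A: "small A q" and "a \<ge> 0" "r \<ge> 0"
  shows "(\<integral>\<^sup>+\<omega>. ennreal (a + r * (\<Sum>j<n. Y j \<omega>)) * indicator A \<omega> \<partial>M) \<le> ennreal (a + r * n) * q"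
proof -
  have [measurable]: "A \<in> events" using A by (rule smallD)
  have "(\<integral>\<^sup>+\<omega>. ennreal (a + r * (\<Sum>j<n. Y j \<omega>)) * indicator A \<omega> \<partial>M)
      = (\<integral>\<^sup>+\<omega>. ennreal a * indicator A \<omega> + (\<Sum>j<n. ennreal r * (ennreal (Y j \<omega>) * indicator A \<omega>)) \<partial>M)"
    using assms(2,3) by (intro nn_integral_cong)
      (auto simp: ennreal_plus ennreal_mult sum_nonneg Y_nonneg sum_distrib_left
            simp flip: sum_ennreal split: split_indicator)
  also have "\<dots> = ennreal a * emeasure M A + (\<Sum>j<n. ennreal r * (\<integral>\<^sup>+\<omega>. ennreal (Y j \<omega>) * indicator A \<omega> \<partial>M))"
    by (simp add: nn_integral_add nn_integral_sum nn_integral_cmult)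
  also have "\<dots> \<le> ennreal a * q + (\<Sum>j<n. ennreal r * q)"
  proof (intro add_mono mult_left_mono sum_mono small_emeasure[OF A])
    fix j
    have "(\<integral>\<^sup>+\<omega>. ennreal (Y j \<omega>) * indicator A \<omega> \<partial>M) \<le> (\<integral>\<^sup>+\<omega>. (1 + ennreal (Y j \<omega>)) * indicator A \<omega> \<partial>M)"
      by (intro nn_integral_mono) (auto split: split_indicator)
    also have "\<dots> \<le> q" using A by (simp add: small_def)
    finally show "(\<integral>\<^sup>+\<omega>. ennreal (Y j \<omega>) * indicator A \<omega> \<partial>M) \<le> q" .
  qed auto
  also have "\<dots> = ennreal (a + r * n) * q"
    using assms(2,3) by (simp add: ennreal_plus ennreal_mult distrib_right distrib_left ennreal_of_nat_eq_real_of_nat mult_ac)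
  finally show ?thesis .
qed

end

section \<open>Lower tails of sums of gaps and upper tails of service times\<close>

text \<open>Multiply by \<open>1 + x + x^2 / 2 \<le> exp x\<close>: the product of the two
  quadratics is \<open>1 + x^4 / 4\<close>.\<close>

lemma exp_minus_le_quadratic:
  assumes "0 \<le> (x::real)"
  shows "exp (- x) \<le> 1 - x + x\<^sup>2 / 2"
proof -
  have 1: "1 \<le> (1 - x + x\<^sup>2 / 2) * (1 + x + x\<^sup>2 / 2)"
  proof -
    have "(1 - x + x\<^sup>2 / 2) * (1 + x + x\<^sup>2 / 2) = 1 + (x\<^sup>2 / 2)\<^sup>2"
      by (simp add: algebra_simps power2_eq_square)
    thus ?thesis by simp
  qed
  have pos: "1 - x + x\<^sup>2 / 2 > 0"
  proof -
    have "1 - x + x\<^sup>2 / 2 = (1 - x)\<^sup>2 / 2 + 1 / 2" by (simp add: power2_eq_square field_simps)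
    thus ?thesis by (simp add: add_nonneg_pos)
  qed
  have "1 \<le> (1 - x + x\<^sup>2 / 2) * exp x"
    using 1 mult_left_mono[OF exp_lower_Taylor_quadratic[OF assms], of "1 - x + x\<^sup>2 / 2"] pos by linarith
  from mult_right_mono[OF this, of "exp (- x)"] show ?thesis
    by (simp add: mult.assoc flip: exp_add)
qed

text \<open>This is \<open>(1 + z / n)^n \<le> exp z\<close> at \<open>z = \<gamma> * k\<close>. It
  turns exponential tails into polynomial ones, so that gaps and service times obey bounds of the
  same form.\<close>

lemma power_times_exp_minus_le:
  assumes "\<gamma> > 0" "n > 0"
  shows "real k ^ n * exp (- \<gamma> * k) \<le> (real n / \<gamma>) ^ n"
proof -
  have "(\<gamma> * k / n) ^ n \<le> (1 + \<gamma> * k / n) ^ n"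
    using assms by (intro power_mono) auto
  also have "\<dots> \<le> exp (\<gamma> * k)"
  proof (rule exp_ge_one_plus_x_over_n_power_n)
    have "0 \<le> \<gamma> * k" using assms by simp
    thus "- real n \<le> \<gamma> * k" by linarith
  qed (use assms in simp)
  finally have "(\<gamma> * k / n) ^ n * exp (- \<gamma> * k) \<le> exp (\<gamma> * k) * exp (- \<gamma> * k)"
    by (intro mult_right_mono) auto
  hence "(\<gamma> * k / n) ^ n * exp (- \<gamma> * k) \<le> 1" by (simp flip: exp_add)
  hence "(n / \<gamma>) ^ n * ((\<gamma> * k / n) ^ n * exp (- \<gamma> * k)) \<le> (n / \<gamma>) ^ n"
    using assms by (intro mult_left_le) auto
  also have "(n / \<gamma>) ^ n * ((\<gamma> * k / n) ^ n * exp (- \<gamma> * k)) = real k ^ n * exp (- \<gamma> * k)"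
    using assms by (simp add: power_mult_distrib power_divide)
  finally show ?thesis .
qed

context iid_queue begin

lemma window_meas[measurable]: "(\<lambda>\<omega>. window (\<lambda>j. Y j \<omega>) h k) \<in> borel_measurable M"
  unfolding window_def by measurable

text \<open>Since \<open>exp (- \<theta> * y)\<close> decreases in \<open>y\<close>, the gap may be
  truncated at a level \<open>b\<close> where its mean still exceeds \<open>c\<close>. The truncated
  gap is bounded, so the quadratic bound on the exponential leaves a negative exponent for small
  \<open>\<theta>\<close>.\<close>

lemma laplace_exponent:
  assumes c: "c < \<mu>"
  obtains \<theta> \<gamma> where "\<theta> > 0" "\<gamma> > 0" "(\<integral>\<^sup>+\<omega>. exp (- \<theta> * (Y 0 \<omega> - c)) \<partial>M) \<le> ennreal (exp (- \<gamma>))"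
proof -
  have "(\<lambda>n. expectation (\<lambda>\<omega>. min (Y 0 \<omega>) (real n))) \<longlonglongrightarrow> \<mu>"
  proof (rule integral_dominated_convergence[where w = "Y 0"])
    show "AE \<omega> in M. (\<lambda>n. min (Y 0 \<omega>) (real n)) \<longlonglongrightarrow> Y 0 \<omega>"
    proof (rule AE_I2)
      fix \<omega>
      have "eventually (\<lambda>n. min (Y 0 \<omega>) (real n) = Y 0 \<omega>) sequentially"
        using eventually_ge_at_top[of "nat \<lceil>Y 0 \<omega>\<rceil>"] by eventually_elim linarith
      thus "(\<lambda>n. min (Y 0 \<omega>) (real n)) \<longlonglongrightarrow> Y 0 \<omega>" by (rule tendsto_eventually)
    qed
    show "AE \<omega> in M. norm (min (Y 0 \<omega>) (real n)) \<le> Y 0 \<omega>" for n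
      using Y_nonneg by (intro AE_I2) (simp add: min_def)
  qed (use Y_int in auto)
  hence "eventually (\<lambda>n. expectation (\<lambda>\<omega>. min (Y 0 \<omega>) (real n)) > c) sequentially"
    using c by (rule order_tendstoD)
  then obtain b :: nat where b: "c < expectation (\<lambda>\<omega>. min (Y 0 \<omega>) (real b))"
    by (auto simp: eventually_sequentially)
  define m where "m = expectation (\<lambda>\<omega>. min (Y 0 \<omega>) (real b))"
  \<comment> \<open>This choice gives \<open>\<theta> * b^2 \<le> m - c\<close>, so the quadratic
    loss eats at most half of the linear gain \<open>\<theta> * (m - c)\<close>. The
    \<open>+ 1\<close> keeps the denominator positive if \<open>b = 0\<close>.\<close>
  define \<theta> where "\<theta> = (m - c) / ((real b)\<^sup>2 + 1)"
  have int: "integrable M (\<lambda>\<omega>. min (Y 0 \<omega>) (real b))"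
    by (rule Bochner_Integration.integrable_bound[OF Y_int]) (auto simp: Y_nonneg min_def)
  define \<gamma> where "\<gamma> = \<theta> * (m - c) - \<theta>\<^sup>2 * (real b)\<^sup>2 / 2"
  have \<theta>: "\<theta> > 0" using b by (simp add: \<theta>_def m_def add_nonneg_pos)
  have "\<theta> * ((real b)\<^sup>2 + 1) = m - c"
    using add_nonneg_pos[of "(real b)\<^sup>2" 1] by (simp add: \<theta>_def)
  hence "m - c \<ge> \<theta> * (real b)\<^sup>2" using \<theta> by (simp add: algebra_simps)
  hence "\<theta> * (m - c) \<ge> \<theta>\<^sup>2 * (real b)\<^sup>2"
    using \<theta> mult_left_mono[of "\<theta> * (real b)\<^sup>2" "m - c" \<theta>] by (simp add: power2_eq_square mult.assoc)
  moreover have "\<theta> * (m - c) > 0" using \<theta> b by (simp add: m_def)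
  ultimately have \<gamma>: "\<gamma> > 0" unfolding \<gamma>_def by (smt (verit) field_sum_of_halves zero_le_mult_iff zero_le_power2)
  have pt: "exp (- \<theta> * (Y 0 \<omega> - c)) \<le> exp (\<theta> * c) * (1 - \<theta> * min (Y 0 \<omega>) b + \<theta>\<^sup>2 * (real b)\<^sup>2 / 2)" for \<omega>
  proof -
    let ?y = "min (Y 0 \<omega>) (real b)"
    have "exp (- \<theta> * (Y 0 \<omega> - c)) \<le> exp (\<theta> * c + - (\<theta> * ?y))"
      using \<theta> by (simp add: algebra_simps)
    also have "\<dots> = exp (\<theta> * c) * exp (- (\<theta> * ?y))" by (rule exp_add)
    also have "exp (- (\<theta> * ?y)) \<le> 1 - \<theta> * ?y + (\<theta> * ?y)\<^sup>2 / 2"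
      using \<theta> Y_nonneg[of 0 \<omega>] by (intro exp_minus_le_quadratic) simp
    also have "(\<theta> * ?y)\<^sup>2 \<le> \<theta>\<^sup>2 * (real b)\<^sup>2"
      using \<theta> Y_nonneg[of 0 \<omega>] by (auto simp: power_mult_distrib intro!: mult_left_mono power_mono)
    finally show ?thesis by (simp add: mult_left_mono)
  qed
  have "(\<integral>\<^sup>+\<omega>. exp (- \<theta> * (Y 0 \<omega> - c)) \<partial>M)
      \<le> (\<integral>\<^sup>+\<omega>. exp (\<theta> * c) * (1 - \<theta> * min (Y 0 \<omega>) b + \<theta>\<^sup>2 * (real b)\<^sup>2 / 2) \<partial>M)"
    using pt by (intro nn_integral_mono ennreal_leI)
  also have "\<dots> = ennreal (exp (\<theta> * c) * (1 - \<theta> * m + \<theta>\<^sup>2 * (real b)\<^sup>2 / 2))"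
  proof (subst nn_integral_eq_integral)
    show "AE \<omega> in M. 0 \<le> exp (\<theta> * c) * (1 - \<theta> * min (Y 0 \<omega>) b + \<theta>\<^sup>2 * (real b)\<^sup>2 / 2)"
      using pt by (intro AE_I2) (meson exp_ge_zero order_trans)
  qed (use int in \<open>simp_all add: m_def prob_space\<close>)
  also have "\<dots> \<le> ennreal (exp (\<theta> * c) * exp (- \<theta> * m + \<theta>\<^sup>2 * (real b)\<^sup>2 / 2))"
  proof (intro ennreal_leI mult_left_mono)
    show "1 - \<theta> * m + \<theta>\<^sup>2 * (real b)\<^sup>2 / 2 \<le> exp (- \<theta> * m + \<theta>\<^sup>2 * (real b)\<^sup>2 / 2)"
      using exp_ge_add_one_self[of "- \<theta> * m + \<theta>\<^sup>2 * (real b)\<^sup>2 / 2"] by linarith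
  qed auto
  also have "\<dots> = ennreal (exp (- \<gamma>))"
    by (simp add: \<gamma>_def algebra_simps flip: exp_add)
  finally show ?thesis using that \<theta> \<gamma> by blast
qed

lemma window_probability:
  assumes \<theta>: "\<theta> > 0" and lap: "(\<integral>\<^sup>+\<omega>. exp (- \<theta> * (Y 0 \<omega> - c)) \<partial>M) \<le> ennreal (exp (- \<gamma>))"
  shows "emeasure M {\<omega>\<in>space M. window (\<lambda>j. Y j \<omega>) h k \<le> c * k} \<le> ennreal (exp (- \<gamma> * k))"
proof -
  have "emeasure M {\<omega>\<in>space M. window (\<lambda>j. Y j \<omega>) h k \<le> c * k}
      = (\<integral>\<^sup>+\<omega>. indicator {\<omega>\<in>space M. window (\<lambda>j. Y j \<omega>) h k \<le> c * k} \<omega> \<partial>M)"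
    by (rule nn_integral_indicator[symmetric]) measurable
  also have "\<dots> \<le> (\<integral>\<^sup>+\<omega>. (\<Prod>j\<in>{h..<h + k}. ennreal (exp (- \<theta> * (Z \<omega> (Inl j) - c)))) \<partial>M)"
  proof (intro nn_integral_mono)
    fix \<omega>
    have "(\<Sum>j\<in>{h..<h + k}. - \<theta> * (Y j \<omega> - c)) = \<theta> * (c * k - window (\<lambda>j. Y j \<omega>) h k)"
      by (simp add: window_def sum_subtractf right_diff_distrib sum_distrib_left sum_negf)
    hence "(\<Prod>j\<in>{h..<h + k}. exp (- \<theta> * (Y j \<omega> - c))) = exp (\<theta> * (c * k - window (\<lambda>j. Y j \<omega>) h k))"
      by (simp flip: exp_sum)
    thus "indicator {\<omega>\<in>space M. window (\<lambda>j. Y j \<omega>) h k \<le> c * k} \<omega>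
        \<le> (\<Prod>j\<in>{h..<h + k}. ennreal (exp (- \<theta> * (Z \<omega> (Inl j) - c))))"
      using \<theta> by (auto simp: prod_ennreal split: split_indicator)
  qed
  also have "\<dots> = (\<Prod>j\<in>{h..<h + k}. \<integral>\<^sup>+\<omega>. ennreal (exp (- \<theta> * (Z \<omega> (Inl j) - c))) \<partial>M)"
    by (rule nn_integral_prod_Z[where K = "\<lambda>j. {Inl j}" and g = "\<lambda>j f. ennreal (exp (- \<theta> * (f (Inl j) - c)))"])
      (auto simp: disjoint_family_on_def)
  also have "\<dots> \<le> (\<Prod>j\<in>{h..<h + k}. ennreal (exp (- \<gamma>)))"
  proof (intro prod_mono_ennreal)
    fix j
    have "(\<integral>\<^sup>+\<omega>. ennreal (exp (- \<theta> * (Z \<omega> (Inl j) - c))) \<partial>M) = (\<integral>\<^sup>+\<omega>. exp (- \<theta> * (Y 0 \<omega> - c)) \<partial>M)"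
      using nn_integral_Y[of "\<lambda>y. ennreal (exp (- \<theta> * (y - c)))" j] by simp
    thus "(\<integral>\<^sup>+\<omega>. ennreal (exp (- \<theta> * (Z \<omega> (Inl j) - c))) \<partial>M) \<le> ennreal (exp (- \<gamma>))"
      using lap by simp
  qed
  also have "\<dots> = ennreal (exp (- \<gamma> * k))"
    by (simp add: ennreal_power mult.commute flip: exp_of_nat_mult)
  finally show ?thesis .
qed

lemma small_indep:
  assumes g: "Measurable.pred (PiM UNIV (\<lambda>_. borel)) P"
    and dep: "\<And>x x'. (\<And>i. i \<in> B \<Longrightarrow> x i = x' i) \<Longrightarrow> P x = P x'" and j: "Inl j \<notin> B"
  shows "(\<integral>\<^sup>+\<omega>. (1 + ennreal (Y j \<omega>)) * indicator {\<omega>\<in>space M. P (Z \<omega>)} \<omega> \<partial>M)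
     = ennreal (1 + \<mu>) * emeasure M {\<omega>\<in>space M. P (Z \<omega>)}"
proof -
  have [measurable]: "Measurable.pred M (\<lambda>\<omega>. P (Z \<omega>))" using measurable_compose[OF Z_meas g] .
  note [measurable] = g
  have "(\<integral>\<^sup>+\<omega>. (1 + ennreal (Y j \<omega>)) * indicator {\<omega>\<in>space M. P (Z \<omega>)} \<omega> \<partial>M)
     = (\<integral>\<^sup>+\<omega>. (1 + ennreal (Z \<omega> (Inl j))) * (if P (Z \<omega>) then 1 else 0) \<partial>M)"
    by (intro nn_integral_cong) (auto split: split_indicator)
  also have "\<dots> = (\<integral>\<^sup>+\<omega>. 1 + ennreal (Z \<omega> (Inl j)) \<partial>M) * (\<integral>\<^sup>+\<omega>. (if P (Z \<omega>) then 1 else 0) \<partial>M)"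
  proof (rule nn_integral_mult_Z[where A = "{Inl j}" and B = B
        and f = "\<lambda>x. 1 + ennreal (x (Inl j))" and g = "\<lambda>x. if P x then 1 else 0"])
    fix x x' assume "\<And>i. i \<in> B \<Longrightarrow> x i = (x' i :: real)"
    thus "(if P x then 1 else 0) = (if P x' then 1 else (0::ennreal))" using dep[of x x'] by simp
  qed (use j in auto)
  also have "(\<integral>\<^sup>+\<omega>. 1 + ennreal (Z \<omega> (Inl j)) \<partial>M) = ennreal (1 + \<mu>)"
    using \<mu>_pos by (simp add: nn_integral_add nn_expectation_Y emeasure_space_1 ennreal_plus)
  also have "(\<integral>\<^sup>+\<omega>. (if P (Z \<omega>) then 1 else 0) \<partial>M) = (\<integral>\<^sup>+\<omega>. indicator {\<omega>\<in>space M. P (Z \<omega>)} \<omega> \<partial>M)"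
    by (intro nn_integral_cong) (auto split: split_indicator)
  finally show ?thesis by simp
qed

text \<open>For \<open>j\<close> inside the window the event itself bounds \<open>Y j\<close> by
  \<open>c * k\<close>; for \<open>j\<close> outside, \<open>Y j\<close> is independent of the event
  and contributes its mean. So the weight costs no more than a factor linear in
  \<open>k\<close>.\<close>

lemma small_window:
  fixes c q :: real
  assumes c: "c \<ge> 0" and q: "emeasure M {\<omega>\<in>space M. window (\<lambda>j. Y j \<omega>) h k \<le> c * k} \<le> ennreal q" "q \<ge> 0"
  shows "small {\<omega>\<in>space M. window (\<lambda>j. Y j \<omega>) h k \<le> c * k} (ennreal ((1 + \<mu> + c * k) * q))"
  unfolding small_def
proof (intro conjI allI)
  let ?E = "{\<omega>\<in>space M. window (\<lambda>j. Y j \<omega>) h k \<le> c * k}"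
  show E: "?E \<in> events" by measurable
  fix j
  have "(\<integral>\<^sup>+\<omega>. (1 + ennreal (Y j \<omega>)) * indicator ?E \<omega> \<partial>M) \<le> ennreal (1 + \<mu> + c * k) * emeasure M ?E"
  proof (cases "j \<in> {h..<h + k}")
    case True
    have "(\<integral>\<^sup>+\<omega>. (1 + ennreal (Y j \<omega>)) * indicator ?E \<omega> \<partial>M)
        \<le> (\<integral>\<^sup>+\<omega>. ennreal (1 + \<mu> + c * k) * indicator ?E \<omega> \<partial>M)"
    proof (intro nn_integral_mono)
      fix \<omega>
      have "Y j \<omega> \<le> window (\<lambda>j. Y j \<omega>) h k"
        unfolding window_def using True by (intro member_le_sum) (auto simp: Y_nonneg)
      moreover have "1 + ennreal (Y j \<omega>) = ennreal (1 + Y j \<omega>)"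
        by (simp add: Y_nonneg ennreal_plus)
      ultimately show "(1 + ennreal (Y j \<omega>)) * indicator ?E \<omega> \<le> ennreal (1 + \<mu> + c * k) * indicator ?E \<omega>"
        using \<mu>_pos by (auto intro!: ennreal_leI split: split_indicator)
    qed
    also have "\<dots> = ennreal (1 + \<mu> + c * k) * emeasure M ?E"
      by (rule nn_integral_cmult_indicator[OF E])
    finally show ?thesis .
  next
    case False
    have "Measurable.pred (PiM UNIV (\<lambda>_. borel)) (\<lambda>x. window (\<lambda>j. x (Inl j)) h k \<le> c * k)"
      unfolding window_def by measurable
    from small_indep[OF this, of "Inl ` {h..<h + k}" j]
    have "(\<integral>\<^sup>+\<omega>. (1 + ennreal (Y j \<omega>)) * indicator ?E \<omega> \<partial>M) = ennreal (1 + \<mu>) * emeasure M ?E"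
      using False by (simp add: window_def image_iff)
    also have "\<dots> \<le> ennreal (1 + \<mu> + c * k) * emeasure M ?E"
      using c \<mu>_pos by (intro mult_right_mono ennreal_leI) auto
    finally show ?thesis .
  qed
  also have "\<dots> \<le> ennreal (1 + \<mu> + c * k) * ennreal q" by (intro mult_left_mono q) auto
  also have "\<dots> = ennreal ((1 + \<mu> + c * k) * q)"
    using c \<mu>_pos q by (simp add: ennreal_mult)
  finally show "(\<integral>\<^sup>+\<omega>. (1 + ennreal (Y j \<omega>)) * indicator ?E \<omega> \<partial>M) \<le> ennreal ((1 + \<mu> + c * k) * q)" .
qed

lemma W_tail:
  assumes "q > 0" "x > 0"
  shows "emeasure M {\<omega>\<in>space M. W l \<omega> > x} \<le> ennreal (expectation (\<lambda>\<omega>. W 0 \<omega> powr q) / x powr q)"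
proof -
  have "emeasure M {\<omega>\<in>space M. W l \<omega> > x} = (\<integral>\<^sup>+\<omega>. indicator {\<omega>\<in>space M. W l \<omega> > x} \<omega> \<partial>M)"
    by (rule nn_integral_indicator[symmetric]) measurable
  also have "\<dots> = (\<integral>\<^sup>+\<omega>. indicator {x<..} (W l \<omega>) \<partial>M)"
    by (intro nn_integral_cong) (auto split: split_indicator)
  also have "\<dots> = (\<integral>\<^sup>+\<omega>. indicator {x<..} (W 0 \<omega>) \<partial>M)" by (rule nn_integral_W) measurable
  also have "\<dots> \<le> (\<integral>\<^sup>+\<omega>. ennreal (W 0 \<omega> powr q / x powr q) \<partial>M)"
  proof (intro nn_integral_mono)
    fix \<omega>
    have "x powr q \<le> W 0 \<omega> powr q" if "x < W 0 \<omega>" using assms that by (intro powr_mono2) auto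
    thus "indicator {x<..} (W 0 \<omega>) \<le> ennreal (W 0 \<omega> powr q / x powr q)"
      using assms by (auto split: split_indicator simp: ennreal_1[symmetric] simp del: ennreal_1)
  qed
  also have "\<dots> = ennreal (expectation (\<lambda>\<omega>. W 0 \<omega> powr q / x powr q))"
    using W_int[OF assms(1)] by (intro nn_integral_eq_integral integrable_divide) auto
  finally show ?thesis by simp
qed

lemma small_service:
  assumes "q > 0" "x > 0"
  shows "small {\<omega>\<in>space M. W l \<omega> > x} (ennreal ((1 + \<mu>) * expectation (\<lambda>\<omega>. W 0 \<omega> powr q) / x powr q))"
  unfolding small_def
proof (intro conjI allI)
  fix j
  have "(\<integral>\<^sup>+\<omega>. (1 + ennreal (Y j \<omega>)) * indicator {\<omega>\<in>space M. W l \<omega> > x} \<omega> \<partial>M)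
      = ennreal (1 + \<mu>) * emeasure M {\<omega>\<in>space M. W l \<omega> > x}"
  proof -
    have "Measurable.pred (PiM UNIV (\<lambda>_. borel)) (\<lambda>z :: nat + nat \<Rightarrow> real. z (Inr l) > x)"
      by measurable
    from small_indep[OF this, of "{Inr l}" j] show ?thesis by simp
  qed
  also have "\<dots> \<le> ennreal (1 + \<mu>) * ennreal (expectation (\<lambda>\<omega>. W 0 \<omega> powr q) / x powr q)"
    by (intro mult_left_mono W_tail assms) auto
  also have "\<dots> = ennreal ((1 + \<mu>) * expectation (\<lambda>\<omega>. W 0 \<omega> powr q) / x powr q)"
    using \<mu>_pos by (subst ennreal_mult[symmetric]) (auto intro!: divide_nonneg_nonneg integral_nonneg_AE)
  finally show "(\<integral>\<^sup>+\<omega>. (1 + ennreal (Y j \<omega>)) * indicator {\<omega>\<in>space M. W l \<omega> > x} \<omega> \<partial>M) \<le>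
    ennreal ((1 + \<mu>) * expectation (\<lambda>\<omega>. W 0 \<omega> powr q) / x powr q)" .
qed measurable

text \<open>The eighth power is generous: summing over lags costs two powers, a union over arrival
  epochs one more, and the rest still has to beat \<open>4 ^ i\<close> at level
  \<open>i\<close>.\<close>

lemma uniform_tails:
  assumes c: "0 < c" "c < \<mu>" and \<delta>: "\<delta> > 0"
  obtains C where "C > 0"
    "\<And>h k. k \<ge> 1 \<Longrightarrow> small {\<omega>\<in>space M. window (\<lambda>j. Y j \<omega>) h k \<le> c * k} (ennreal (C / real k ^ 8))"
    "\<And>l s k. s \<ge> 1 \<Longrightarrow> real s powr (1 + \<delta>) \<le> real k \<Longrightarrow>
       small {\<omega>\<in>space M. W l \<omega> > c * k / real s} (ennreal (C / real k ^ 8))"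
proof -
  obtain \<theta> \<gamma> where \<theta>: "\<theta> > 0" "\<gamma> > 0" "(\<integral>\<^sup>+\<omega>. exp (- \<theta> * (Y 0 \<omega> - c)) \<partial>M) \<le> ennreal (exp (- \<gamma>))"
    by (rule laplace_exponent[OF c(2)])
  \<comment> \<open>The power is 9 rather than 8 because \<open>small_window\<close> brings in a
    factor linear in \<open>k\<close>.\<close>
  define C1 where "C1 = (1 + \<mu> + c) * (9 / \<gamma>) ^ 9"
  \<comment> \<open>From \<open>s^(1 + \<delta>) \<le> k\<close> follows
    \<open>k^a \<le> k / s\<close>, so Markov's inequality for the moment of order
    \<open>q = 8 / a\<close> yields a tail of order \<open>k^(-8)\<close>.\<close>
  define a where "a = \<delta> / (1 + \<delta>)"
  define q where "q = 8 / a"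
  have a: "a > 0" "q > 0" using \<delta> by (simp_all add: a_def q_def)
  define C2 where "C2 = (1 + \<mu>) * expectation (\<lambda>\<omega>. W 0 \<omega> powr q) / c powr q"
  define C where "C = C1 + C2"
  have C1: "C1 > 0" using \<mu>_pos c \<theta> by (simp add: C1_def)
  have C2: "C2 \<ge> 0" using \<mu>_pos c by (auto simp: C2_def intro!: divide_nonneg_nonneg mult_nonneg_nonneg integral_nonneg_AE)
  show ?thesis
  proof (rule that[of C])
    show "C > 0" using C1 C2 by (simp add: C_def)
  next
    fix h k :: nat assume k: "k \<ge> 1"
    have "(1 + \<mu> + c * k) * exp (- \<gamma> * k) \<le> ((1 + \<mu> + c) * k) * exp (- \<gamma> * k)"
    proof (intro mult_right_mono)
      have "1 + \<mu> \<le> (1 + \<mu>) * k" using k \<mu>_pos by simp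
      thus "1 + \<mu> + c * k \<le> (1 + \<mu> + c) * k" by (simp add: algebra_simps)
    qed auto
    also have "\<dots> = (1 + \<mu> + c) * (real k ^ 9 * exp (- \<gamma> * k)) / real k ^ 8"
      using k by (simp add: eval_nat_numeral)
    also have "\<dots> \<le> (1 + \<mu> + c) * (9 / \<gamma>) ^ 9 / real k ^ 8"
      using power_times_exp_minus_le[OF \<theta>(2), of 9 k] \<mu>_pos c
      by (intro divide_right_mono mult_left_mono) auto
    also have "\<dots> \<le> C / real k ^ 8"
      using C2 by (intro divide_right_mono) (auto simp: C_def C1_def)
    finally have "ennreal ((1 + \<mu> + c * k) * exp (- \<gamma> * k)) \<le> ennreal (C / real k ^ 8)"
      by (rule ennreal_leI)
    thus "small {\<omega>\<in>space M. window (\<lambda>j. Y j \<omega>) h k \<le> c * k} (ennreal (C / real k ^ 8))"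
      using c by (intro small_mono[OF small_window[OF _ window_probability[OF \<theta>(1,3)]]]) auto
  next
    fix l s k :: nat assume s: "s \<ge> 1" "real s powr (1 + \<delta>) \<le> real k"
    have "1 \<le> real s powr (1 + \<delta>)" using s \<delta> by (intro ge_one_powr_ge_zero) auto
    hence k: "real k \<ge> 1" using s by linarith
    have "real s = (real s powr (1 + \<delta>)) powr (1 / (1 + \<delta>))"
      using s \<delta> by (simp add: powr_powr)
    also have "\<dots> \<le> real k powr (1 / (1 + \<delta>))" using s \<delta> by (intro powr_mono2) auto
    finally have "real k powr a * real s \<le> real k powr a * real k powr (1 / (1 + \<delta>))"
      by (intro mult_left_mono) auto
    also have "\<dots> = real k powr 1"
      using \<delta> by (simp add: a_def field_simps flip: powr_add add_divide_distrib)
    finally have "real k powr a \<le> real k / real s" using s k by (simp add: field_simps)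
    hence "c * real k powr a \<le> c * real k / real s"
      using c mult_left_mono[of "real k powr a" "real k / real s" c] by simp
    hence "(c * real k powr a) powr q \<le> (c * k / real s) powr q"
      using c a k by (intro powr_mono2) auto
    moreover have "(c * real k powr a) powr q = c powr q * real k ^ 8"
      using c k a by (simp add: powr_mult powr_powr q_def powr_realpow)
    ultimately have *: "c powr q * real k ^ 8 \<le> (c * k / real s) powr q" by simp
    have "(1 + \<mu>) * expectation (\<lambda>\<omega>. W 0 \<omega> powr q) / (c * k / real s) powr q
        \<le> (1 + \<mu>) * expectation (\<lambda>\<omega>. W 0 \<omega> powr q) / (c powr q * real k ^ 8)"
      using * c k \<mu>_pos s by (intro divide_left_mono) (auto intro!: mult_nonneg_nonneg integral_nonneg_AE mult_pos_pos)
    also have "\<dots> = C2 / real k ^ 8" by (simp add: C2_def)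
    also have "\<dots> \<le> C / real k ^ 8" using C1 by (intro divide_right_mono) (auto simp: C_def)
    finally have "ennreal ((1 + \<mu>) * expectation (\<lambda>\<omega>. W 0 \<omega> powr q) / (c * k / real s) powr q) \<le> ennreal (C / real k ^ 8)"
      by (rule ennreal_leI)
    thus "small {\<omega>\<in>space M. W l \<omega> > c * k / real s} (ennreal (C / real k ^ 8))"
      using c k s a by (intro small_mono[OF small_service[of q]]) auto
  qed
qed

end

section \<open>Failure of a single attempt, of all attempts at a level, and of the tail\<close>

text \<open>This locality is what makes attempts in disjoint blocks independent.
  \<open>K \<le> B\<close> keeps the lags below \<open>K\<close>, counted from some
  \<open>h \<le> n\<close>, inside the range ending at \<open>n + B\<close>.\<close>

lemma attempt_ok_cong:
  assumes "K \<le> B" "K \<le> n" "\<And>j. j \<in> {n - K..<n + B} \<Longrightarrow> y j = y' j \<and> w j = w' j"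
  shows "attempt_ok c s K B n y w = attempt_ok c s K B n y' w'"
proof -
  have win: "window y h k = window y' h k" if "n - K \<le> h" "h + k \<le> n + B" for h k
    unfolding window_def using that by (intro sum.cong) (auto simp: assms(3))
  have 1: "(\<forall>l\<in>{n - K<..<n + K}. w l \<le> c * K / s) = (\<forall>l\<in>{n - K<..<n + K}. w' l \<le> c * K / s)"
    using assms by (intro ball_cong) auto
  have 2: "window y (n - K) K = window y' (n - K) K" using assms(1,2) by (intro win) auto
  have 3: "(\<Sum>k<K. of_bool (w (h + k) > window y h k / s)) = 
      (\<Sum>k<K. of_bool (w' (h + k) > window y' h k / s) :: real)" if "h \<in> {n - K<..n}" for h
  proof (intro sum.cong refl)
    fix k assume "k \<in> {..<K}"
    hence "window y h k = window y' h k" "w (h + k) = w' (h + k)"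
      using that assms by (auto intro!: win)
    thus "of_bool (w (h + k) > window y h k / s) = (of_bool (w' (h + k) > window y' h k / s) :: real)"
      by simp
  qed
  have 4: "(w (h + k) \<le> c * k / s \<and> c * k < window y h k) = (w' (h + k) \<le> c * k / s \<and> c * k < window y' h k)"
    if "h \<in> {n - K<..n}" "k \<in> {K..<B}" for h k
  proof -
    have "window y h k = window y' h k" "w (h + k) = w' (h + k)"
      using that assms by (auto intro!: win)
    thus ?thesis by simp
  qed
  have 5: "(\<forall>h\<in>{n - K<..n}. (\<Sum>k<K. of_bool (w (h + k) > window y h k / s)) \<le> real s) =
      (\<forall>h\<in>{n - K<..n}. (\<Sum>k<K. of_bool (w' (h + k) > window y' h k / s)) \<le> real s)"
    by (rule ball_cong[OF refl]) (simp only: 3)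
  have 6: "(\<forall>h\<in>{n - K<..n}. \<forall>k\<in>{K..<B}. w (h + k) \<le> c * k / s \<and> c * k < window y h k) =
      (\<forall>h\<in>{n - K<..n}. \<forall>k\<in>{K..<B}. w' (h + k) \<le> c * k / s \<and> c * k < window y' h k)"
    by (intro ball_cong refl) (rule 4)
  show ?thesis unfolding attempt_ok_def 1 2 5 6 ..
qed

lemma attempt_ok_pred:
  "Measurable.pred (PiM UNIV (\<lambda>_. borel)) (\<lambda>x. attempt_ok c s K B n (\<lambda>j. x (Inl j)) (\<lambda>j. x (Inr j)))"
  unfolding attempt_ok_def window_def of_bool_def by measurable

lemma tail_ok_pred:
  "Measurable.pred (PiM UNIV (\<lambda>_. borel)) (\<lambda>x. tail_ok c s B N (\<lambda>j. x (Inl j)) (\<lambda>j. x (Inr j)))"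
  unfolding tail_ok_def window_def by measurable

definition basel :: real where "basel = (\<Sum>i. 1 / real (Suc i) ^ 2)"

lemma basel_summable: "summable (\<lambda>i. 1 / real (Suc i) ^ 2)"
  using inverse_power_summable[of 2, where 'a = real] summable_Suc_iff[of "\<lambda>i. 1 / real i ^ 2"]
  by (simp add: divide_inverse)

lemma basel_nonneg: "basel \<ge> 0"
  unfolding basel_def using basel_summable by (intro suminf_nonneg) auto

context iid_queue begin

lemma attempt_ok_meas[measurable]:
  "Measurable.pred M (\<lambda>\<omega>. attempt_ok c s K B n (\<lambda>j. Y j \<omega>) (\<lambda>j. W j \<omega>))"
  using measurable_compose[OF Z_meas attempt_ok_pred[of c s K B n]] by simp

lemma tail_ok_meas[measurable]:
  "Measurable.pred M (\<lambda>\<omega>. tail_ok c s B N (\<lambda>j. Y j \<omega>) (\<lambda>j. W j \<omega>))"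
  using measurable_compose[OF Z_meas tail_ok_pred[of c s B N]] by simp

text \<open>Splitting \<open>(B + i)^8 \<ge> B^6 * (i + 1)^2\<close> spends two powers on
  convergence of the sum and keeps six as decay in \<open>B\<close>.\<close>

lemma small_tail_Union:
  assumes B: "B \<ge> 1" and C: "C \<ge> 0" and E: "\<And>k. k \<ge> B \<Longrightarrow> small (E k) (ennreal (C / real k ^ 8))"
  shows "small (\<Union>k\<in>{B..}. E k) (ennreal (C * basel / real B ^ 6))"
proof -
  have "small (\<Union>i. E (B + i)) (\<Sum>i. ennreal (C / real (B + i) ^ 8))"
    by (rule small_Union, rule E) simp
  moreover have "(\<Union>i. E (B + i)) = (\<Union>k\<in>{B..}. E k)"
    by (auto simp: le_iff_add intro!: bexI)
  moreover have "(\<Sum>i. ennreal (C / real (B + i) ^ 8)) \<le> (\<Sum>i. ennreal (C / real B ^ 6 * (1 / real (Suc i) ^ 2)))"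
  proof (intro suminf_le ennreal_leI)
    fix i
    have "real B ^ 6 * real (Suc i) ^ 2 \<le> real (B + i) ^ 6 * real (B + i) ^ 2"
      using B by (intro mult_mono power_mono) auto
    also have "\<dots> = real (B + i) ^ 8" by (simp flip: power_add)
    finally have "C / real (B + i) ^ 8 \<le> C / (real B ^ 6 * real (Suc i) ^ 2)"
      using B C by (intro divide_left_mono) auto
    thus "C / real (B + i) ^ 8 \<le> C / real B ^ 6 * (1 / real (Suc i) ^ 2)" by simp
  qed auto
  moreover have "(\<Sum>i. ennreal (C / real B ^ 6 * (1 / real (Suc i) ^ 2))) = ennreal (C * basel / real B ^ 6)"
  proof -
    have "(\<Sum>i. ennreal (C / real B ^ 6 * (1 / real (Suc i) ^ 2))) = ennreal (\<Sum>i. C / real B ^ 6 * (1 / real (Suc i) ^ 2))"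
      using C basel_summable by (intro suminf_ennreal2 summable_mult) auto
    also have "(\<Sum>i. C / real B ^ 6 * (1 / real (Suc i) ^ 2)) = C / real B ^ 6 * basel"
      unfolding basel_def by (rule suminf_mult[OF basel_summable])
    finally show ?thesis by simp
  qed
  ultimately show ?thesis by (auto intro: small_mono)
qed

text \<open>With windows replaced by the line \<open>c * k / s - \<eta>\<close>, the summands are
  independent indicators and Chernoff's bound applies. At most
  \<open>1 + s * (w + \<eta>) / c\<close> lags \<open>k\<close> have a threshold below a given
  \<open>w\<close>; taking \<open>w\<close> to be a typical service time and averaging bounds the
  expected count by \<open>1 + s * r\<close>. The factor \<open>lam + lam^2\<close> comes from
  \<open>exp lam - 1 \<le> lam + lam^2\<close> on \<open>[0, 1]\<close>.\<close>

lemma service_count_probability: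
  assumes c: "c > 0" and \<eta>: "\<eta> \<ge> 0" and s: "s \<ge> 1" and lam: "0 < lam" "lam \<le> 1"
  defines "r \<equiv> (\<nu> + \<eta>) / c"
  shows "emeasure M {\<omega>\<in>space M. (\<Sum>k<K. of_bool (W (h + k) \<omega> > c * k / real s - \<eta>)) > real s}
    \<le> ennreal (exp ((lam + lam\<^sup>2) * (1 + s * r) - lam * s))"
proof -
  define E where "E k w \<longleftrightarrow> w > c * real k / real s - \<eta>" for k :: nat and w :: real
  define p where "p k = prob {\<omega>\<in>space M. E k (W 0 \<omega>)}" for k
  have [measurable]: "Measurable.pred borel (E k)" for k unfolding E_def by measurable
  have p_sum: "(\<Sum>k<K. p k) \<le> 1 + s * r"
  proof -
    have "(\<Sum>k<K. p k) = (\<Sum>k<K. expectation (indicator {\<omega>\<in>space M. E k (W 0 \<omega>)}))"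
      by (simp add: p_def)
    also have "\<dots> = expectation (\<lambda>\<omega>. \<Sum>k<K. indicator {\<omega>\<in>space M. E k (W 0 \<omega>)} \<omega>)"
      by (rule Bochner_Integration.integral_sum[symmetric])
        (auto intro!: integrable_real_indicator simp: emeasure_eq_measure)
    also have "\<dots> \<le> expectation (\<lambda>\<omega>. 1 + (W 0 \<omega> + \<eta>) * (s / c))"
    proof (intro integral_mono)
      fix \<omega> assume \<omega>: "\<omega> \<in> space M"
      define x where "x = (W 0 \<omega> + \<eta>) * (s / c)"
      have x0: "x \<ge> 0" using c \<eta> W_nonneg by (simp add: x_def)
      have "E k (W 0 \<omega>) \<longleftrightarrow> real k < x" for k
        using s c by (auto simp: E_def x_def field_simps)
      hence "(\<Sum>k<K. indicator {\<omega>\<in>space M. E k (W 0 \<omega>)} \<omega>) = (\<Sum>k<K. if real k < x then 1 else 0 :: real)"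
        using \<omega> by (intro sum.cong) auto
      also have "\<dots> = real (card {k\<in>{..<K}. real k < x})" by (simp add: sum.If_cases Int_def)
      also have "card {k\<in>{..<K}. real k < x} \<le> card {..<nat \<lceil>x\<rceil>}"
        by (intro card_mono) (auto, linarith)
      also have "real (card {..<nat \<lceil>x\<rceil>}) \<le> 1 + x" using x0 by simp linarith
      finally show "(\<Sum>k<K. indicator {\<omega>\<in>space M. E k (W 0 \<omega>)} \<omega>) \<le> 1 + (W 0 \<omega> + \<eta>) * (s / c)"
        by (simp add: x_def)
    qed (use W_integrable in \<open>auto intro!: integrable_real_indicator simp: emeasure_eq_measure\<close>)
    also have "\<dots> = 1 + s * r"
      using W_integrable by (simp add: prob_space r_def)
    finally show ?thesis .
  qed
  have one: "(\<integral>\<^sup>+\<omega>. ennreal (exp (lam * of_bool (E k (W l \<omega>)))) \<partial>M) \<le> ennreal (exp ((lam + lam\<^sup>2) * p k))" for k l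
  proof -
    have "(\<integral>\<^sup>+\<omega>. ennreal (exp (lam * of_bool (E k (W l \<omega>)))) \<partial>M)
       = (\<integral>\<^sup>+\<omega>. ennreal (exp (lam * of_bool (E k (W 0 \<omega>)))) \<partial>M)"
      by (rule nn_integral_W) (unfold of_bool_def, measurable)
    also have "\<dots> = (\<integral>\<^sup>+\<omega>. 1 + ennreal (exp lam - 1) * indicator {\<omega>\<in>space M. E k (W 0 \<omega>)} \<omega> \<partial>M)"
      using lam ennreal_plus[of 1 "exp lam - 1"] by (intro nn_integral_cong) (auto split: split_indicator)
    also have "\<dots> = 1 + ennreal (exp lam - 1) * ennreal (p k)"
      by (simp add: nn_integral_add nn_integral_cmult_indicator emeasure_space_1 prob_space p_def emeasure_eq_measure)
    also have "\<dots> = ennreal (1 + (exp lam - 1) * p k)"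
      using lam by (simp add: p_def ennreal_plus ennreal_mult)
    also have "\<dots> \<le> ennreal (exp ((lam + lam\<^sup>2) * p k))"
    proof (rule ennreal_leI)
      have "(exp lam - 1) * p k \<le> (lam + lam\<^sup>2) * p k"
        using exp_bound[of lam] lam by (intro mult_right_mono) (auto simp: p_def)
      also have "1 + \<dots> \<le> exp ((lam + lam\<^sup>2) * p k)" by (rule exp_ge_add_one_self)
      finally show "1 + (exp lam - 1) * p k \<le> exp ((lam + lam\<^sup>2) * p k)" by simp
    qed
    finally show ?thesis .
  qed
  let ?A = "{\<omega>\<in>space M. (\<Sum>k<K. of_bool (W (h + k) \<omega> > c * k / real s - \<eta>)) > real s}"
  have [measurable]: "?A \<in> events" unfolding of_bool_def by measurable
  have "emeasure M ?A = (\<integral>\<^sup>+\<omega>. indicator ?A \<omega> \<partial>M)" by simp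
  also have "\<dots> \<le> (\<integral>\<^sup>+\<omega>. ennreal (exp (- lam * s)) * (\<Prod>k<K. ennreal (exp (lam * of_bool (E k (Z \<omega> (Inr (h + k))))))) \<partial>M)"
  proof (intro nn_integral_mono)
    fix \<omega>
    have "(\<Prod>k<K. exp (lam * of_bool (E k (W (h + k) \<omega>)))) = exp (lam * (\<Sum>k<K. of_bool (E k (W (h + k) \<omega>))))"
      by (simp add: sum_distrib_left flip: exp_sum)
    hence "ennreal (exp (- lam * s)) * (\<Prod>k<K. ennreal (exp (lam * of_bool (E k (Z \<omega> (Inr (h + k)))))))
       = ennreal (exp (lam * ((\<Sum>k<K. of_bool (E k (W (h + k) \<omega>))) - real s)))"
      by (simp add: prod_ennreal algebra_simps flip: ennreal_mult exp_add)
    moreover have "0 \<le> lam * ((\<Sum>k<K. of_bool (E k (W (h + k) \<omega>))) - real s)" if "\<omega> \<in> ?A"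
      using that lam by (intro mult_nonneg_nonneg) (auto simp: E_def)
    ultimately show "indicator ?A \<omega> \<le> ennreal (exp (- lam * s)) * (\<Prod>k<K. ennreal (exp (lam * of_bool (E k (Z \<omega> (Inr (h + k)))))))"
      by (cases "\<omega> \<in> ?A") auto
  qed
  also have "\<dots> = ennreal (exp (- lam * s)) * (\<integral>\<^sup>+\<omega>. (\<Prod>k<K. ennreal (exp (lam * of_bool (E k (Z \<omega> (Inr (h + k))))))) \<partial>M)"
    by (rule nn_integral_cmult) (unfold of_bool_def, measurable)
  also have "(\<integral>\<^sup>+\<omega>. (\<Prod>k<K. ennreal (exp (lam * of_bool (E k (Z \<omega> (Inr (h + k))))))) \<partial>M)
     = (\<Prod>k<K. \<integral>\<^sup>+\<omega>. ennreal (exp (lam * of_bool (E k (Z \<omega> (Inr (h + k)))))) \<partial>M)"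
  proof (rule nn_integral_prod_Z[where K = "\<lambda>k. {Inr (h + k)}"
        and g = "\<lambda>k x. ennreal (exp (lam * of_bool (E k (x (Inr (h + k))))))"])
    show "(\<lambda>x. ennreal (exp (lam * of_bool (E k (x (Inr (h + k))))))) \<in> borel_measurable (PiM UNIV (\<lambda>_. borel))" for k
      unfolding of_bool_def by measurable
  qed (auto simp: disjoint_family_on_def)
  also have "\<dots> \<le> (\<Prod>k<K. ennreal (exp ((lam + lam\<^sup>2) * p k)))"
    using one by (intro prod_mono_ennreal) auto
  also have "\<dots> = ennreal (exp ((lam + lam\<^sup>2) * (\<Sum>k<K. p k)))"
    by (simp add: prod_ennreal sum_distrib_left flip: exp_sum)
  also have "\<dots> \<le> ennreal (exp ((lam + lam\<^sup>2) * (1 + s * r)))"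
    using p_sum lam by (intro ennreal_leI) (auto intro!: mult_left_mono)
  finally show ?thesis
    by (simp add: mult_left_mono flip: ennreal_mult exp_add)
qed


lemma small_UN_const:
  assumes "finite I" "card I \<le> m" "q \<ge> 0" "\<And>i. i \<in> I \<Longrightarrow> small (A i) (ennreal q)"
  shows "small (\<Union>i\<in>I. A i) (ennreal (real m * q))"
proof (rule small_mono)
  show "small (\<Union>i\<in>I. A i) (\<Sum>i\<in>I. ennreal q)" using assms by (intro small_UN_finite) auto
  have "(\<Sum>i\<in>I. ennreal q) = ennreal (real (card I) * q)"
    using assms(3) by (simp add: ennreal_mult ennreal_of_nat_eq_real_of_nat)
  also have "\<dots> \<le> ennreal (real m * q)" using assms(2,3) by (intro ennreal_leI mult_right_mono) auto
  finally show "(\<Sum>i\<in>I. ennreal q) \<le> ennreal (real m * q)" .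
qed

lemma small_Un_real:
  "small A (ennreal q) \<Longrightarrow> small B (ennreal r) \<Longrightarrow> q \<ge> 0 \<Longrightarrow> r \<ge> 0 \<Longrightarrow> small (A \<union> B) (ennreal (q + r))"
  using small_Un[of A "ennreal q" B "ennreal r"] by (simp add: ennreal_plus)

text \<open>Gaps and service times enter jointly. Where windows are reliable they are replaced by
  the line \<open>c * k / s\<close>; what remains is a count of service times alone whose mean is at
  most \<open>1 + r * s\<close> with \<open>r < 1\<close>, so exceeding \<open>s\<close> is a large
  deviation.\<close>

lemma small_overload:
  assumes c: "\<nu> < c" and C: "C > 0"
    and win: "\<And>h k. k \<ge> 1 \<Longrightarrow> small {\<omega>\<in>space M. window (\<lambda>j. Y j \<omega>) h k \<le> c * k} (ennreal (C / real k ^ 8))"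
  obtains C' where "C' > 0"
    "\<And>s K h. s \<ge> 1 \<Longrightarrow> small {\<omega>\<in>space M.
       (\<Sum>k<K. of_bool (W (h + k) \<omega> > window (\<lambda>j. Y j \<omega>) h k / real s)) > real s} (ennreal (C' / real s ^ 6))"
proof -
  have c0: "c > 0" using c \<nu>_nonneg by linarith
  \<comment> \<open>Half of the room between \<open>\<nu>\<close> and \<open>c\<close> is spent on
    the slack \<open>\<eta>\<close>; the other half keeps the load \<open>r\<close> below 1.\<close>
  define \<eta> where "\<eta> = (c - \<nu>) / 2"
  define r where "r = (\<nu> + \<eta>) / c"
  define lam where "lam = (1 - r) / 2"
  \<comment> \<open>\<open>\<kappa>\<close> is the decay rate in \<open>s\<close>: the exponent of
    the Chernoff bound equals \<open>lam + lam^2 - \<kappa> * s\<close>.\<close>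
  define \<kappa> where "\<kappa> = lam * (1 - (1 + lam) * r)"
  have \<eta>: "\<eta> > 0" "\<nu> + \<eta> < c" using c by (simp_all add: \<eta>_def field_simps)
  have r: "0 \<le> r" "r < 1" using \<eta> \<nu>_nonneg c0 by (simp_all add: r_def)
  have lam: "0 < lam" "lam \<le> 1" using r by (simp_all add: lam_def)
  have "1 - (1 + lam) * r = (1 - r) * (2 - r) / 2" by (simp add: lam_def field_simps)
  moreover have "(1 - r) * (2 - r) / 2 > 0" using r by simp
  ultimately have \<kappa>: "\<kappa> > 0" using lam unfolding \<kappa>_def by (simp only: mult_pos_pos)
  define C1 where "C1 = C * basel * (c / \<eta>) ^ 6"
  define C2 where "C2 = (1 + \<mu>) * exp 2 * (6 / \<kappa>) ^ 6"
  have C1: "C1 \<ge> 0" using C c0 \<eta> basel_nonneg by (simp add: C1_def)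
  have C2: "C2 > 0" using \<mu>_pos \<kappa> by (simp add: C2_def)
  show ?thesis
  proof (rule that[of "C1 + C2"])
    show "C1 + C2 > 0" using C1 C2 by simp
    fix s K h :: nat assume s: "s \<ge> 1"
    \<comment> \<open>Below lag \<open>k1\<close> the threshold \<open>c * k / s - \<eta>\<close> is
      negative, so every customer is counted anyway. Windows need control only from
      \<open>k1\<close> on, and \<open>k1\<close> is of order \<open>s\<close>, which turns decay in
      the lag into decay in \<open>s\<close>.\<close>
    define k1 where "k1 = nat \<lceil>\<eta> * s / c\<rceil>"
    have k1: "\<eta> * s / c \<le> k1" "k1 \<ge> 1"
    proof -
      have "0 < \<eta> * s / c" using \<eta> c0 s by simp
      thus "k1 \<ge> 1" unfolding k1_def by linarith
      show "\<eta> * s / c \<le> k1" unfolding k1_def by linarith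
    qed
    let ?A = "\<Union>k\<in>{k1..}. {\<omega>\<in>space M. window (\<lambda>j. Y j \<omega>) h k \<le> c * k}"
    let ?P = "\<lambda>w. (\<Sum>k<K. of_bool (w (h + k) > c * k / real s - \<eta>)) > real s"
    let ?B = "{\<omega>\<in>space M. ?P (\<lambda>k. W k \<omega>)}"
    have "small ?A (ennreal (C * basel / real k1 ^ 6))"
      using C k1 by (intro small_tail_Union win) auto
    moreover have "C * basel / real k1 ^ 6 \<le> C1 / real s ^ 6"
    proof -
      have "C * basel / real k1 ^ 6 \<le> C * basel / (\<eta> * s / c) ^ 6"
        using k1 \<eta> c0 s C basel_nonneg by (intro divide_left_mono power_mono) auto
      also have "\<dots> = C1 / real s ^ 6" by (simp add: C1_def power_mult_distrib power_divide)
      finally show ?thesis .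
    qed
    ultimately have A: "small ?A (ennreal (C1 / real s ^ 6))"
      by (auto intro: small_mono ennreal_leI)
    have "(lam + lam\<^sup>2) * (1 + s * r) - lam * s = lam + lam\<^sup>2 - \<kappa> * s"
      by (simp add: \<kappa>_def power2_eq_square algebra_simps)
    moreover have "lam\<^sup>2 \<le> 1" using lam by (simp add: power_le_one)
    ultimately have ex: "(lam + lam\<^sup>2) * (1 + s * r) - lam * s \<le> 2 + - \<kappa> * s"
      using lam by linarith
    have "exp ((lam + lam\<^sup>2) * (1 + s * r) - lam * s) \<le> exp 2 * exp (- \<kappa> * s)"
      using ex by (simp flip: exp_add)
    also have "exp (- \<kappa> * s) \<le> (6 / \<kappa>) ^ 6 / real s ^ 6"
      using power_times_exp_minus_le[OF \<kappa>, of 6 s] s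
      by (subst pos_le_divide_eq) (simp_all add: mult.commute)
    finally have "exp ((lam + lam\<^sup>2) * (1 + s * r) - lam * s) \<le> exp 2 * ((6 / \<kappa>) ^ 6 / real s ^ 6)"
      by simp
    hence ex_le: "ennreal (exp ((lam + lam\<^sup>2) * (1 + s * r) - lam * s)) \<le> ennreal (exp 2 * ((6 / \<kappa>) ^ 6 / real s ^ 6))"
      by (rule ennreal_leI)
    have "emeasure M ?B \<le> ennreal (exp ((lam + lam\<^sup>2) * (1 + s * r) - lam * s))"
      unfolding r_def using \<eta> s lam c0 by (intro service_count_probability) auto
    hence PB: "emeasure M ?B \<le> ennreal (exp 2 * ((6 / \<kappa>) ^ 6 / real s ^ 6))"
      using ex_le by (rule order_trans)
    have B: "small ?B (ennreal (C2 / real s ^ 6))"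
      unfolding small_def
    proof (intro conjI allI)
      show "?B \<in> events" unfolding of_bool_def by measurable
      fix j
      have m: "Measurable.pred (PiM UNIV (\<lambda>_. borel)) (\<lambda>z :: nat + nat \<Rightarrow> real. ?P (\<lambda>k. z (Inr k)))"
        unfolding of_bool_def by measurable
      have "(\<integral>\<^sup>+\<omega>. (1 + ennreal (Y j \<omega>)) * indicator ?B \<omega> \<partial>M) = ennreal (1 + \<mu>) * emeasure M ?B"
        using small_indep[OF m, of "range Inr" j] by (simp add: image_iff)
      also have "\<dots> \<le> ennreal (1 + \<mu>) * ennreal (exp 2 * ((6 / \<kappa>) ^ 6 / real s ^ 6))"
        using PB by (intro mult_left_mono) auto
      also have "\<dots> = ennreal (C2 / real s ^ 6)"
        using \<mu>_pos \<kappa> by (subst ennreal_mult[symmetric]) (auto simp: C2_def)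
      finally show "(\<integral>\<^sup>+\<omega>. (1 + ennreal (Y j \<omega>)) * indicator ?B \<omega> \<partial>M) \<le> ennreal (C2 / real s ^ 6)" .
    qed
    have AB: "small (?A \<union> ?B) (ennreal ((C1 + C2) / real s ^ 6))"
      using small_Un_real[OF A B] C1 C2 by (simp add: add_divide_distrib)
    let ?E = "{\<omega>\<in>space M. (\<Sum>k<K. of_bool (W (h + k) \<omega> > window (\<lambda>j. Y j \<omega>) h k / real s)) > real s}"
    have "?E \<subseteq> ?A \<union> ?B"
    proof
      fix \<omega> assume \<omega>: "\<omega> \<in> ?E"
      show "\<omega> \<in> ?A \<union> ?B"
      proof (rule ccontr)
        assume no: "\<omega> \<notin> ?A \<union> ?B"
        have "of_bool (W (h + k) \<omega> > window (\<lambda>j. Y j \<omega>) h k / real s)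
            \<le> (of_bool (W (h + k) \<omega> > c * k / real s - \<eta>) :: real)" for k
        proof (cases "k1 \<le> k")
          case True
          hence "c * k < window (\<lambda>j. Y j \<omega>) h k" using no \<omega> by force
          hence "c * k / s \<le> window (\<lambda>j. Y j \<omega>) h k / s" by (simp add: divide_right_mono)
          thus ?thesis using \<eta> by (auto simp: of_bool_def)
        next
          case False
          hence "real k < \<eta> * s / c" unfolding k1_def by linarith
          hence "c * k / s < \<eta>" using c0 s by (simp add: field_simps)
          thus ?thesis using W_nonneg[of "h + k" \<omega>] by (auto simp: of_bool_def)
        qed
        hence "(\<Sum>k<K. of_bool (W (h + k) \<omega> > window (\<lambda>j. Y j \<omega>) h k / real s))
            \<le> (\<Sum>k<K. of_bool (W (h + k) \<omega> > c * k / real s - \<eta>) :: real)"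
          by (intro sum_mono)
        moreover have "\<omega> \<notin> ?B" using no by blast
        hence "(\<Sum>k<K. of_bool (W (h + k) \<omega> > c * k / real s - \<eta>)) \<le> real s" using \<omega> by auto
        ultimately show False using \<omega> by auto
      qed
    qed
    thus "small ?E (ennreal ((C1 + C2) / real s ^ 6))"
      by (rule small_subset[OF AB]) (unfold of_bool_def, measurable)
  qed
qed

lemma small_lag:
  assumes C: "C > 0" and K: "1 \<le> K"
    and win: "\<And>h k. k \<ge> 1 \<Longrightarrow> small {\<omega>\<in>space M. window (\<lambda>j. Y j \<omega>) h k \<le> c * k} (ennreal (C / real k ^ 8))"
    and serv: "\<And>l k. k \<ge> K \<Longrightarrow> small {\<omega>\<in>space M. W l \<omega> > c * k / real s} (ennreal (C / real k ^ 8))"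
  shows "small (\<Union>k\<in>{K..}. {\<omega>\<in>space M. W (h + k) \<omega> > c * k / real s} \<union>
     {\<omega>\<in>space M. window (\<lambda>j. Y j \<omega>) h k \<le> c * k}) (ennreal (2 * C * basel / real K ^ 6))"
proof (rule small_tail_Union)
  fix k assume k: "k \<ge> K"
  have "small ({\<omega>\<in>space M. W (h + k) \<omega> > c * k / real s} \<union>
     {\<omega>\<in>space M. window (\<lambda>j. Y j \<omega>) h k \<le> c * k}) (ennreal (C / real k ^ 8 + C / real k ^ 8))"
    using C K k by (intro small_Un_real win serv) auto
  thus "small ({\<omega>\<in>space M. W (h + k) \<omega> > c * k / real s} \<union>
     {\<omega>\<in>space M. window (\<lambda>j. Y j \<omega>) h k \<le> c * k}) (ennreal (2 * C / real k ^ 8))"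
    by simp
qed (use C K in auto)

text \<open>The lags in \<open>{K..<B}\<close> are enlarged to all lags from \<open>K\<close> on, so
  the bound does not depend on \<open>B\<close> and serves at every level. The assumption
  \<open>K \<le> 2 s^2\<close> pays for the union of overload events over \<open>K\<close> arrival
  epochs: a factor of order \<open>s^2\<close> against \<open>s^(-6)\<close>.\<close>

lemma small_attempt_failure:
  assumes C: "C > 0" "C' > 0" and s: "s \<ge> 1" and K: "1 \<le> K" "s \<le> K" "real K \<le> 2 * (real s)\<^sup>2"
    and win: "\<And>h k. k \<ge> 1 \<Longrightarrow> small {\<omega>\<in>space M. window (\<lambda>j. Y j \<omega>) h k \<le> c * k} (ennreal (C / real k ^ 8))"
    and serv: "\<And>l k. k \<ge> K \<Longrightarrow> small {\<omega>\<in>space M. W l \<omega> > c * k / real s} (ennreal (C / real k ^ 8))"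
    and over: "\<And>h. small {\<omega>\<in>space M.
       (\<Sum>k<K. of_bool (W (h + k) \<omega> > window (\<lambda>j. Y j \<omega>) h k / real s)) > real s} (ennreal (C' / real s ^ 6))"
  shows "small {\<omega>\<in>space M. \<not> attempt_ok c s K B n (\<lambda>j. Y j \<omega>) (\<lambda>j. W j \<omega>)}
    (ennreal ((3 * C + 2 * C' + 2 * C * basel) / s))"
proof -
  let ?A1 = "\<Union>l\<in>{n - K<..<n + K}. {\<omega>\<in>space M. W l \<omega> > c * K / real s}"
  let ?A2 = "{\<omega>\<in>space M. window (\<lambda>j. Y j \<omega>) (n - K) K \<le> c * K}"
  let ?A3 = "\<Union>h\<in>{n - K<..n}. {\<omega>\<in>space M.
       (\<Sum>k<K. of_bool (W (h + k) \<omega> > window (\<lambda>j. Y j \<omega>) h k / real s)) > real s}"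
  let ?A4 = "\<Union>h\<in>{n - K<..n}. \<Union>k\<in>{K..}. {\<omega>\<in>space M. W (h + k) \<omega> > c * k / real s} \<union>
     {\<omega>\<in>space M. window (\<lambda>j. Y j \<omega>) h k \<le> c * k}"
  have 1: "small ?A1 (ennreal (real (2 * K) * (C / real K ^ 8)))"
    using C by (intro small_UN_const serv) auto
  have 2: "small ?A2 (ennreal (C / real K ^ 8))" using K by (intro win)
  have 3: "small ?A3 (ennreal (real K * (C' / real s ^ 6)))"
    using C by (intro small_UN_const over) auto
  have 4: "small ?A4 (ennreal (real K * (2 * C * basel / real K ^ 6)))"
    using C K basel_nonneg by (intro small_UN_const small_lag win serv) auto
  have "small (?A1 \<union> (?A2 \<union> (?A3 \<union> ?A4))) (ennreal (real (2 * K) * (C / real K ^ 8) +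
      (C / real K ^ 8 + (real K * (C' / real s ^ 6) + real K * (2 * C * basel / real K ^ 6)))))"
    using C basel_nonneg by (intro small_Un_real 1 2 3 4) auto
  hence "small {\<omega>\<in>space M. \<not> attempt_ok c s K B n (\<lambda>j. Y j \<omega>) (\<lambda>j. W j \<omega>)}
     (ennreal (real (2 * K) * (C / real K ^ 8) +
      (C / real K ^ 8 + (real K * (C' / real s ^ 6) + real K * (2 * C * basel / real K ^ 6)))))"
  proof (rule small_subset)
    show "{\<omega>\<in>space M. \<not> attempt_ok c s K B n (\<lambda>j. Y j \<omega>) (\<lambda>j. W j \<omega>)} \<subseteq> ?A1 \<union> (?A2 \<union> (?A3 \<union> ?A4))"
    proof
      fix \<omega> assume \<omega>: "\<omega> \<in> {\<omega>\<in>space M. \<not> attempt_ok c s K B n (\<lambda>j. Y j \<omega>) (\<lambda>j. W j \<omega>)}"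
      show "\<omega> \<in> ?A1 \<union> (?A2 \<union> (?A3 \<union> ?A4))"
      proof (rule ccontr)
        assume "\<omega> \<notin> ?A1 \<union> (?A2 \<union> (?A3 \<union> ?A4))"
        hence n1: "\<omega> \<notin> ?A1" and n2: "\<omega> \<notin> ?A2" and n3: "\<omega> \<notin> ?A3" and n4: "\<omega> \<notin> ?A4"
          by (simp_all only: Un_iff de_Morgan_disj simp_thms)
        have "attempt_ok c s K B n (\<lambda>j. Y j \<omega>) (\<lambda>j. W j \<omega>)"
          unfolding attempt_ok_def
        proof (intro conjI ballI)
          fix l assume "l \<in> {n - K<..<n + K}"
          thus "W l \<omega> \<le> c * K / s" using n1 \<omega> by (auto simp: not_less not_le)
        next
          show "c * K < window (\<lambda>j. Y j \<omega>) (n - K) K" using n2 \<omega> by auto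
        next
          fix h assume "h \<in> {n - K<..n}"
          thus "(\<Sum>k<K. of_bool (W (h + k) \<omega> > window (\<lambda>j. Y j \<omega>) h k / real s)) \<le> real s"
            using n3 \<omega> by (auto simp: not_less not_le)
        next
          fix h k assume "h \<in> {n - K<..n}" "k \<in> {K..<B}"
          thus "W (h + k) \<omega> \<le> c * k / s" "c * k < window (\<lambda>j. Y j \<omega>) h k"
            using n4 \<omega> by (auto simp: not_less not_le)
        qed
        thus False using \<omega> by simp
      qed
    qed
  qed measurable
  moreover have "real (2 * K) * (C / real K ^ 8) +
      (C / real K ^ 8 + (real K * (C' / real s ^ 6) + real K * (2 * C * basel / real K ^ 6)))
      \<le> (3 * C + 2 * C' + 2 * C * basel) / s"
  proof -
    have Kp: "real s \<le> real K ^ m" if "m \<ge> 1" for m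
    proof -
      have "real K ^ 1 \<le> real K ^ m" using K that by (intro power_increasing) auto
      thus ?thesis using K by simp
    qed
    have "real (2 * K) * (C / real K ^ 8) = 2 * C / real K ^ 7" using K by (simp add: eval_nat_numeral)
    also have "\<dots> \<le> 2 * C / s" using Kp[of 7] C s K by (intro divide_left_mono) auto
    finally have a: "real (2 * K) * (C / real K ^ 8) \<le> 2 * C / s" .
    have b: "C / real K ^ 8 \<le> C / s" using Kp[of 8] C s K by (intro divide_left_mono) auto
    have "real K * (C' / real s ^ 6) \<le> 2 * (real s)\<^sup>2 * (C' / real s ^ 6)"
      using K C by (intro mult_right_mono) auto
    also have "\<dots> = 2 * C' / real s ^ 4" using s by (simp add: eval_nat_numeral)
    also have "\<dots> \<le> 2 * C' / s"
    proof -
      have "real s ^ 1 \<le> real s ^ 4" using s by (intro power_increasing) auto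
      thus ?thesis using C s by (intro divide_left_mono) auto
    qed
    finally have d: "real K * (C' / real s ^ 6) \<le> 2 * C' / s" .
    have "real K * (2 * C * basel / real K ^ 6) = 2 * C * basel / real K ^ 5"
      using K by (simp add: eval_nat_numeral)
    also have "\<dots> \<le> 2 * C * basel / s"
      using Kp[of 5] C s K basel_nonneg by (intro divide_left_mono) auto
    finally have e: "real K * (2 * C * basel / real K ^ 6) \<le> 2 * C * basel / s" .
    have "(3 * C + 2 * C' + 2 * C * basel) / s = 2 * C / s + (C / s + (2 * C' / s + 2 * C * basel / s))"
      by (simp add: add_divide_distrib[symmetric])
    thus ?thesis using a b d e by linarith
  qed
  ultimately show ?thesis by (auto intro: small_mono ennreal_leI)
qed

text \<open>The epoch of attempt \<open>b\<close> is the midpoint of a block of \<open>2 * B\<close>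
  indices, and by \<open>K \<le> B\<close> the attempt reads nothing outside it. Of the
  \<open>i + 1\<close> independent factors one may be lost to the weight \<open>1 + Y j\<close>,
  which leaves \<open>4 ^ i\<close>.\<close>

lemma small_all_attempts_fail:
  assumes K: "1 \<le> K" "K \<le> B"
    and fail: "\<And>n. emeasure M {\<omega>\<in>space M. \<not> attempt_ok c s K B n (\<lambda>j. Y j \<omega>) (\<lambda>j. W j \<omega>)} \<le> ennreal (1 / 4)"
  shows "small {\<omega>\<in>space M. \<forall>b\<le>i. \<not> attempt_ok c s K B (2 * B * b + B) (\<lambda>j. Y j \<omega>) (\<lambda>j. W j \<omega>)}
    (ennreal ((1 + \<mu>) / 4 ^ i))"
  unfolding small_def
proof (intro conjI allI)
  let ?ok = "\<lambda>x b. attempt_ok c s K B (2 * B * b + B) (\<lambda>j. x (Inl j)) (\<lambda>j. x (Inr j))"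
  let ?E = "\<lambda>J. {\<omega>\<in>space M. \<forall>b\<in>J. \<not> ?ok (Z \<omega>) b}"
  define R where "R b = (Inl ` {2 * B * b..<2 * B * b + 2 * B} \<union> Inr ` {2 * B * b..<2 * B * b + 2 * B} :: (nat + nat) set)" for b
  note [measurable] = attempt_ok_pred
  have cong: "?ok x b = ?ok x' b" if "\<And>i. i \<in> R b \<Longrightarrow> x i = (x' i :: real)" for x x' b
    using K that by (intro attempt_ok_cong) (auto simp: R_def)
  \<comment> \<open>The block of an index is its quotient by \<open>2 * B\<close>; this gives
    disjointness and also identifies the one block that can contain \<open>j\<close>.\<close>
  have Rdiv: "x div (2 * B) = b" if "2 * B * b \<le> x" "x < 2 * B * b + 2 * B" for x b
    using that by (intro div_nat_eqI) (auto simp: algebra_simps)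
  have disj: "disjoint_family_on R J" for J
    unfolding disjoint_family_on_def R_def using Rdiv by (auto; blast)
  have E: "{\<omega>\<in>space M. \<forall>b\<le>i. \<not> attempt_ok c s K B (2 * B * b + B) (\<lambda>j. Y j \<omega>) (\<lambda>j. W j \<omega>)} = ?E {..i}"
    by auto
  show "{\<omega>\<in>space M. \<forall>b\<le>i. \<not> attempt_ok c s K B (2 * B * b + B) (\<lambda>j. Y j \<omega>) (\<lambda>j. W j \<omega>)} \<in> events"
    by measurable
  fix j
  text \<open>The attempt whose block contains the index \<open>j\<close> is dropped; the others are independent of \<open>Y j\<close>.\<close>
  define J where "J = {..i} - {j div (2 * B)}"
  have J: "finite J" "card J \<ge> i" by (auto simp: J_def card_Diff_singleton_if)
  have "emeasure M (?E J) = (\<integral>\<^sup>+\<omega>. (\<Prod>b\<in>J. if ?ok (Z \<omega>) b then 0 else 1) \<partial>M)"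
  proof -
    have "emeasure M (?E J) = (\<integral>\<^sup>+\<omega>. indicator (?E J) \<omega> \<partial>M)"
      by (rule nn_integral_indicator[symmetric]) (simp, measurable)
    also have "\<dots> = (\<integral>\<^sup>+\<omega>. (\<Prod>b\<in>J. if ?ok (Z \<omega>) b then 0 else 1) \<partial>M)"
      using J by (intro nn_integral_cong) (auto split: split_indicator intro!: prod_zero[symmetric])
    finally show ?thesis .
  qed
  also have "\<dots> = (\<Prod>b\<in>J. \<integral>\<^sup>+\<omega>. (if ?ok (Z \<omega>) b then 0 else 1) \<partial>M)"
  proof (rule nn_integral_prod_Z[OF J(1) disj, where g = "\<lambda>b x. if ?ok x b then 0 else 1"])
    fix b f f' assume "\<And>i. i \<in> R b \<Longrightarrow> f i = (f' i :: real)"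
    thus "(if ?ok f b then 0 else 1) = (if ?ok f' b then 0 else (1 :: ennreal))"
      using cong[of b f f'] by simp
  qed measurable
  also have "\<dots> \<le> (\<Prod>b\<in>J. ennreal (1 / 4))"
  proof (rule prod_mono_ennreal)
    fix b
    have "(\<integral>\<^sup>+\<omega>. (if ?ok (Z \<omega>) b then 0 else 1) \<partial>M) =
       (\<integral>\<^sup>+\<omega>. indicator {\<omega>\<in>space M. \<not> ?ok (Z \<omega>) b} \<omega> \<partial>M)"
      by (intro nn_integral_cong) (auto split: split_indicator)
    also have "\<dots> = emeasure M {\<omega>\<in>space M. \<not> ?ok (Z \<omega>) b}"
      by (rule nn_integral_indicator) (simp, measurable)
    also have "\<dots> \<le> ennreal (1 / 4)" using fail by simp
    finally show "(\<integral>\<^sup>+\<omega>. (if ?ok (Z \<omega>) b then 0 else 1) \<partial>M) \<le> ennreal (1 / 4)" .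
  qed
  also have "\<dots> = ennreal ((1 / 4) ^ card J)" by (simp only: prod_constant) (simp add: ennreal_power)
  also have "\<dots> \<le> ennreal ((1 / 4) ^ i)" using J by (intro ennreal_leI power_decreasing) auto
  finally have P: "emeasure M (?E J) \<le> ennreal ((1 / 4) ^ i)" .
  have "(\<integral>\<^sup>+\<omega>. (1 + ennreal (Y j \<omega>)) * indicator (?E {..i}) \<omega> \<partial>M)
      \<le> (\<integral>\<^sup>+\<omega>. (1 + ennreal (Y j \<omega>)) * indicator (?E J) \<omega> \<partial>M)"
    by (intro nn_integral_mono mult_left_mono) (auto simp: J_def split: split_indicator)
  also have "\<dots> = ennreal (1 + \<mu>) * emeasure M (?E J)"
  proof (rule small_indep[where B = "\<Union>b\<in>J. R b" and P = "\<lambda>x. \<forall>b\<in>J. \<not> ?ok x b"])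
    show "Measurable.pred (PiM UNIV (\<lambda>_. borel)) (\<lambda>x. \<forall>b\<in>J. \<not> ?ok x b)"
      using J(1) by measurable
    show "(\<forall>b\<in>J. \<not> ?ok x b) = (\<forall>b\<in>J. \<not> ?ok x' b)" if "\<And>i. i \<in> (\<Union>b\<in>J. R b) \<Longrightarrow> x i = x' i" for x x'
      using cong[of _ x x'] that by (intro ball_cong refl arg_cong[where f = Not]) blast
    show "Inl j \<notin> (\<Union>b\<in>J. R b)"
      using Rdiv by (auto simp: J_def R_def)
  qed
  also have "\<dots> \<le> ennreal (1 + \<mu>) * ennreal ((1 / 4) ^ i)" using P by (intro mult_left_mono) auto
  also have "\<dots> = ennreal ((1 + \<mu>) / 4 ^ i)"
    using \<mu>_pos by (subst ennreal_mult[symmetric]) (auto simp: power_divide)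
  finally show "(\<integral>\<^sup>+\<omega>. (1 + ennreal (Y j \<omega>)) * indicator {\<omega>\<in>space M. \<forall>b\<le>i. \<not> attempt_ok c s K B (2 * B * b + B) (\<lambda>j. Y j \<omega>) (\<lambda>j. W j \<omega>)} \<omega> \<partial>M)
     \<le> ennreal ((1 + \<mu>) / 4 ^ i)" by (simp only: E)
qed

lemma small_tail_failure:
  assumes C: "C > 0" and K: "1 \<le> K" "K \<le> B"
    and win: "\<And>h k. k \<ge> 1 \<Longrightarrow> small {\<omega>\<in>space M. window (\<lambda>j. Y j \<omega>) h k \<le> c * k} (ennreal (C / real k ^ 8))"
    and serv: "\<And>l k. k \<ge> K \<Longrightarrow> small {\<omega>\<in>space M. W l \<omega> > c * k / real s} (ennreal (C / real k ^ 8))"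
  shows "small {\<omega>\<in>space M. \<not> tail_ok c s B N (\<lambda>j. Y j \<omega>) (\<lambda>j. W j \<omega>)}
    (ennreal (B * (C / real B ^ 8) + real (N + 1) * (2 * C * basel / real B ^ 6)))"
proof -
  let ?A1 = "\<Union>l\<in>{..<B}. {\<omega>\<in>space M. W l \<omega> > c * B / real s}"
  let ?A2 = "\<Union>h\<in>{..N}. \<Union>k\<in>{B..}. {\<omega>\<in>space M. W (h + k) \<omega> > c * k / real s} \<union>
     {\<omega>\<in>space M. window (\<lambda>j. Y j \<omega>) h k \<le> c * k}"
  have 1: "small ?A1 (ennreal (real B * (C / real B ^ 8)))"
    using C K by (intro small_UN_const serv) auto
  have 2: "small ?A2 (ennreal (real (N + 1) * (2 * C * basel / real B ^ 6)))"
    using C K basel_nonneg by (intro small_UN_const small_lag win serv) auto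
  have "small (?A1 \<union> ?A2) (ennreal (B * (C / real B ^ 8) + real (N + 1) * (2 * C * basel / real B ^ 6)))"
    using C basel_nonneg small_Un_real[OF 1 2] by simp
  thus ?thesis
  proof (rule small_subset)
    show "{\<omega>\<in>space M. \<not> tail_ok c s B N (\<lambda>j. Y j \<omega>) (\<lambda>j. W j \<omega>)} \<subseteq> ?A1 \<union> ?A2"
    proof
      fix \<omega> assume \<omega>: "\<omega> \<in> {\<omega>\<in>space M. \<not> tail_ok c s B N (\<lambda>j. Y j \<omega>) (\<lambda>j. W j \<omega>)}"
      show "\<omega> \<in> ?A1 \<union> ?A2"
      proof (rule ccontr)
        assume "\<omega> \<notin> ?A1 \<union> ?A2"
        hence n1: "\<omega> \<notin> ?A1" and n2: "\<omega> \<notin> ?A2" by (simp_all only: Un_iff de_Morgan_disj simp_thms)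
        have "tail_ok c s B N (\<lambda>j. Y j \<omega>) (\<lambda>j. W j \<omega>)"
          unfolding tail_ok_def
        proof (intro conjI allI impI)
          fix l assume "l < B"
          thus "W l \<omega> \<le> c * B / s" using n1 \<omega> by (auto simp: not_less not_le)
        next
          fix h k assume "h \<le> N" "B \<le> k"
          thus "W (h + k) \<omega> \<le> c * k / s" "c * k < window (\<lambda>j. Y j \<omega>) h k"
            using n2 \<omega> by (auto simp: not_less not_le)
        qed
        thus False using \<omega> by simp
      qed
    qed
  qed measurable
qed

end

section \<open>Summation over the levels\<close>

lemma quadratic_over_exponential_summable: "summable (\<lambda>i. (real i + 2)\<^sup>2 / 2 ^ i)"
proof (rule summable_ratio_test[of "25 / 32" 2])
  fix n :: nat assume n: "n \<ge> 2"
  \<comment> \<open>From \<open>n = 2\<close> on, \<open>(n + 3) / (n + 2) \<le> 5 / 4\<close>, and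
    \<open>(5 / 4)^2 / 2 = 25 / 32\<close>.\<close>
  have "real (Suc n) + 2 \<le> 5 / 4 * (real n + 2)" using n by simp
  hence "(real (Suc n) + 2)\<^sup>2 \<le> (5 / 4 * (real n + 2))\<^sup>2" by (intro power_mono) auto
  also have "\<dots> = 25 / 16 * (real n + 2)\<^sup>2"
    by (subst power_mult_distrib) (simp add: power2_eq_square)
  finally have "(real (Suc n) + 2)\<^sup>2 / 2 ^ Suc n \<le> 25 / 16 * (real n + 2)\<^sup>2 / 2 ^ Suc n"
    by (intro divide_right_mono) auto
  thus "norm ((real (Suc n) + 2)\<^sup>2 / 2 ^ Suc n) \<le> 25 / 32 * norm ((real n + 2)\<^sup>2 / 2 ^ n)"
    by simp
qed simp

context iid_queue begin

text \<open>The bound of \<open>abs_tauf_le\<close> with \<open>B = 2 ^ i * K\<close> and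
  \<open>N = 2 * B * (i + 1)\<close>; this \<open>N\<close> lies beyond the epochs
  \<open>2 * B * b + B\<close> of all attempts \<open>b \<le> i\<close>.\<close>

definition level_time :: "real \<Rightarrow> nat \<Rightarrow> nat \<Rightarrow> nat \<Rightarrow> 'a \<Rightarrow> real" where
  "level_time c s K i \<omega> = c * real (2 ^ i * K) / s + (\<Sum>j<2 * (2 ^ i * K) * (i + 1). Y j \<omega>) / s"

definition level_failure :: "real \<Rightarrow> nat \<Rightarrow> nat \<Rightarrow> nat \<Rightarrow> 'a set" where
  "level_failure c s K i =
     {\<omega>\<in>space M. \<forall>b\<le>i. \<not> attempt_ok c s K (2 ^ i * K) (2 * (2 ^ i * K) * b + 2 ^ i * K) (\<lambda>j. Y j \<omega>) (\<lambda>j. W j \<omega>)} \<union>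
     {\<omega>\<in>space M. \<not> tail_ok c s (2 ^ i * K) (2 * (2 ^ i * K) * (i + 1)) (\<lambda>j. Y j \<omega>) (\<lambda>j. W j \<omega>)}"

text \<open>The time of level \<open>i + 1\<close> is charged to the failure of level
  \<open>i\<close> alone, since the first level to succeed is preceded by a failing one. The added 1
  makes every charged term at least 1, so the sum is infinite where all levels fail and the bound
  holds there too.\<close>

definition coalescence_bound :: "real \<Rightarrow> nat \<Rightarrow> nat \<Rightarrow> 'a \<Rightarrow> ennreal" where
  "coalescence_bound c s K \<omega> = ennreal (1 + level_time c s K 0 \<omega>) +
     (\<Sum>i. ennreal (1 + level_time c s K (Suc i) \<omega>) * indicator (level_failure c s K i) \<omega>)"

lemma level_time_nonneg: "c \<ge> 0 \<Longrightarrow> level_time c s K i \<omega> \<ge> 0"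
  unfolding level_time_def by (simp add: Y_nonneg sum_nonneg)

lemma level_time_le_coalescence_bound:
  assumes \<omega>: "\<omega> \<in> space M" and c: "c \<ge> 0"
    and x: "\<And>i. \<omega> \<notin> level_failure c s K i \<Longrightarrow> x \<le> ennreal (level_time c s K i \<omega>)"
  shows "x \<le> coalescence_bound c s K \<omega>"
proof -
  have le: "ennreal (level_time c s K i \<omega>) \<le> ennreal (1 + level_time c s K i \<omega>)" for i
    by (intro ennreal_leI) simp
  show ?thesis
  proof (cases "\<exists>i. \<omega> \<notin> level_failure c s K i")
    case True
    define i where "i = (LEAST i. \<omega> \<notin> level_failure c s K i)"
    have i: "\<omega> \<notin> level_failure c s K i" unfolding i_def using True by (rule LeastI_ex)
    have imin: "\<omega> \<in> level_failure c s K j" if "j < i" for j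
      using not_less_Least[of j] that unfolding i_def by blast
    show ?thesis
    proof (cases i)
      case 0
      have "x \<le> ennreal (1 + level_time c s K 0 \<omega>)" using order_trans[OF x[OF i] le] 0 by simp
      also have "\<dots> \<le> coalescence_bound c s K \<omega>" unfolding coalescence_bound_def by simp
      finally show ?thesis .
    next
      case (Suc j)
      let ?f = "\<lambda>i. ennreal (1 + level_time c s K (Suc i) \<omega>) * indicator (level_failure c s K i) \<omega>"
      have "x \<le> ennreal (1 + level_time c s K (Suc j) \<omega>)" using order_trans[OF x[OF i] le] Suc by simp
      also have "\<dots> = sum ?f {j}" using imin[of j] Suc by simp
      also have "\<dots> \<le> (\<Sum>i. ?f i)" by (rule sum_le_suminf) auto
      also have "\<dots> \<le> coalescence_bound c s K \<omega>" unfolding coalescence_bound_def by simp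
      finally show ?thesis .
    qed
  next
    case False
    let ?f = "\<lambda>i. ennreal (1 + level_time c s K (Suc i) \<omega>) * indicator (level_failure c s K i) \<omega>"
    have 1: "1 \<le> ?f i" for i
      using False level_time_nonneg[OF c, of s K "Suc i" \<omega>] by (simp add: ennreal_plus)
    have "of_nat n \<le> (\<Sum>i. ?f i)" for n :: nat
    proof -
      have "of_nat n = (\<Sum>i<n. 1 :: ennreal)" by simp
      also have "\<dots> \<le> (\<Sum>i<n. ?f i)" using 1 by (intro sum_mono)
      also have "\<dots> \<le> (\<Sum>i. ?f i)" by (rule sum_le_suminf) auto
      finally show ?thesis .
    qed
    hence "(\<Sum>i. ?f i) = \<top>"
      by (metis ennreal_Ex_less_of_nat linorder_not_less top.not_eq_extremum)
    thus ?thesis by (simp add: coalescence_bound_def)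
  qed
qed

lemma small_space: "small (space M) (ennreal (1 + \<mu>))"
  unfolding small_def
proof (intro conjI allI)
  fix j
  have "(\<integral>\<^sup>+\<omega>. (1 + ennreal (Y j \<omega>)) * indicator (space M) \<omega> \<partial>M) = (\<integral>\<^sup>+\<omega>. 1 + ennreal (Y j \<omega>) \<partial>M)"
    by (intro nn_integral_cong) simp
  also have "\<dots> = ennreal (1 + \<mu>)"
    using \<mu>_pos by (simp add: nn_integral_add nn_expectation_Y emeasure_space_1 ennreal_plus)
  finally show "(\<integral>\<^sup>+\<omega>. (1 + ennreal (Y j \<omega>)) * indicator (space M) \<omega> \<partial>M) \<le> ennreal (1 + \<mu>)" by simp
qed simp

lemma level_time_integral:
  assumes "small A (ennreal q)" "c \<ge> 0" "q \<ge> 0"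
  shows "(\<integral>\<^sup>+\<omega>. ennreal (1 + level_time c s K i \<omega>) * indicator A \<omega> \<partial>M)
     \<le> ennreal ((1 + (c + 2 * (real i + 1)) * (2 ^ i * real K / s)) * q)"
proof -
  have "(\<integral>\<^sup>+\<omega>. ennreal (1 + level_time c s K i \<omega>) * indicator A \<omega> \<partial>M)
      = (\<integral>\<^sup>+\<omega>. ennreal ((1 + c * real (2 ^ i * K) / s) + 1 / s * (\<Sum>j<2 * (2 ^ i * K) * (i + 1). Y j \<omega>)) * indicator A \<omega> \<partial>M)"
    by (simp add: level_time_def add.assoc)
  also have "\<dots> \<le> ennreal ((1 + c * real (2 ^ i * K) / s) + 1 / s * real (2 * (2 ^ i * K) * (i + 1))) * ennreal q"
    using assms(2) by (intro small_integral assms(1)) auto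
  also have "\<dots> = ennreal (((1 + c * real (2 ^ i * K) / s) + 1 / s * real (2 * (2 ^ i * K) * (i + 1))) * q)"
    using assms(2,3) by (intro ennreal_mult[symmetric]) auto
  also have "(1 + c * real (2 ^ i * K) / s) + 1 / s * real (2 * (2 ^ i * K) * (i + 1))
      = 1 + (c + 2 * (real i + 1)) * (2 ^ i * real K / s)"
    by (simp add: add_divide_distrib algebra_simps)
  finally show ?thesis .
qed

text \<open>Level \<open>i + 1\<close> reaches back by order \<open>(i + 2) * 2 ^ i * K / s\<close>,
  and the failure of level \<open>i\<close> has weighted size of order
  \<open>(i + 2) / 4 ^ i\<close>. The products are of order \<open>(i + 2)^2 / 2 ^ i\<close> times
  \<open>K / s\<close>, hence summable.\<close>

lemma expected_coalescence_bound:
  assumes c: "c > 0" and C: "C > 0" and s: "1 \<le> s" and K: "s \<le> K"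
    and win: "\<And>h k. k \<ge> 1 \<Longrightarrow> small {\<omega>\<in>space M. window (\<lambda>j. Y j \<omega>) h k \<le> c * k} (ennreal (C / real k ^ 8))"
    and serv: "\<And>l k. k \<ge> K \<Longrightarrow> small {\<omega>\<in>space M. W l \<omega> > c * k / real s} (ennreal (C / real k ^ 8))"
    and fail: "\<And>B n. B \<ge> K \<Longrightarrow>
      emeasure M {\<omega>\<in>space M. \<not> attempt_ok c s K B n (\<lambda>j. Y j \<omega>) (\<lambda>j. W j \<omega>)} \<le> ennreal (1 / 4)"
  shows "(\<integral>\<^sup>+\<omega>. coalescence_bound c s K \<omega> \<partial>M) \<le> ennreal (((3 + c) * (1 + \<mu>) +
     (5 + 2 * c) * (1 + \<mu> + C + 4 * C * basel) * (\<Sum>i. (real i + 2)\<^sup>2 / 2 ^ i)) * (K / s))"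
proof -
  define c2 where "c2 = 1 + \<mu> + C + 4 * C * basel"
  have K1: "K \<ge> 1" using K s by simp
  have Ks: "1 \<le> real K / real s" using K s by simp
  have c2: "c2 > 0" using \<mu>_pos C basel_nonneg by (simp add: c2_def add_pos_nonneg)
  have bad: "small (level_failure c s K i) (ennreal (c2 * (real i + 2) / 4 ^ i))" for i
  proof -
    define B where "B = 2 ^ i * K"
    define N where "N = 2 * B * (i + 1)"
    have B: "K \<le> B" "2 ^ i \<le> B" using K1 by (simp_all add: B_def)
    have B1: "B \<ge> 1" using B K1 by simp
    \<comment> \<open>Since \<open>2 ^ i \<le> B\<close>, two powers of \<open>B\<close> already
      match the decay of the repeated attempts, so the tail failure is no worse than theirs up to
      the factor \<open>i + 2\<close>.\<close>
    have B4: "4 ^ i \<le> real B ^ m" if "m \<ge> 2" for m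
    proof -
      have "4 ^ i = ((2::real) ^ i)\<^sup>2" by (simp add: power2_eq_square flip: power_mult_distrib)
      also have "\<dots> \<le> real B ^ 2" using B(2) by (intro power_mono) (simp_all flip: of_nat_power add: numeral_power_le_of_nat_cancel_iff)
      also have "\<dots> \<le> real B ^ m" using B1 that by (intro power_increasing) auto
      finally show ?thesis .
    qed
    have "small (level_failure c s K i) (ennreal ((1 + \<mu>) / 4 ^ i +
        (B * (C / real B ^ 8) + real (N + 1) * (2 * C * basel / real B ^ 6))))"
      unfolding level_failure_def B_def[symmetric] N_def[symmetric]
    proof (rule small_Un_real)
      show "small {\<omega>\<in>space M. \<forall>b\<le>i. \<not> attempt_ok c s K B (2 * B * b + B) (\<lambda>j. Y j \<omega>) (\<lambda>j. W j \<omega>)}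
          (ennreal ((1 + \<mu>) / 4 ^ i))"
        using B K1 by (intro small_all_attempts_fail fail) auto
      show "small {\<omega>\<in>space M. \<not> tail_ok c s B N (\<lambda>j. Y j \<omega>) (\<lambda>j. W j \<omega>)}
          (ennreal (B * (C / real B ^ 8) + real (N + 1) * (2 * C * basel / real B ^ 6)))"
        using C K1 B by (intro small_tail_failure win serv) auto
    qed (use \<mu>_pos C basel_nonneg in auto)
    moreover have "(1 + \<mu>) / 4 ^ i + (B * (C / real B ^ 8) + real (N + 1) * (2 * C * basel / real B ^ 6))
        \<le> c2 * (real i + 2) / 4 ^ i"
    proof -
      have a: "(1 + \<mu>) / 4 ^ i \<le> (1 + \<mu>) * (real i + 2) / 4 ^ i"
        using \<mu>_pos by (intro divide_right_mono) auto
      have "B * (C / real B ^ 8) = C / real B ^ 7" using B1 by (simp add: eval_nat_numeral)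
      also have "\<dots> \<le> C / 4 ^ i" using B4[of 7] C B1 by (intro divide_left_mono) auto
      also have "\<dots> \<le> C * (real i + 2) / 4 ^ i" using C by (intro divide_right_mono) auto
      finally have b: "B * (C / real B ^ 8) \<le> C * (real i + 2) / 4 ^ i" .
      have "real (N + 1) \<le> 2 * real B * (real i + 2)" using B1 by (simp add: N_def algebra_simps)
      hence "real (N + 1) * (2 * C * basel / real B ^ 6) \<le> 2 * real B * (real i + 2) * (2 * C * basel / real B ^ 6)"
        using C basel_nonneg by (intro mult_right_mono) auto
      also have "\<dots> = 4 * C * basel * (real i + 2) / real B ^ 5" using B1 by (simp add: eval_nat_numeral)
      also have "\<dots> \<le> 4 * C * basel * (real i + 2) / 4 ^ i"
        using B4[of 5] C B1 basel_nonneg by (intro divide_left_mono) auto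
      finally have d: "real (N + 1) * (2 * C * basel / real B ^ 6) \<le> 4 * C * basel * (real i + 2) / 4 ^ i" .
      have "c2 * (real i + 2) / 4 ^ i = (1 + \<mu>) * (real i + 2) / 4 ^ i + (C * (real i + 2) / 4 ^ i + 4 * C * basel * (real i + 2) / 4 ^ i)"
        by (simp add: c2_def distrib_right add_divide_distrib)
      thus ?thesis using a b d by linarith
    qed
    ultimately show ?thesis by (auto intro: small_mono ennreal_leI)
  qed
  have [measurable]: "level_failure c s K i \<in> events" for i using bad by (rule smallD)
  have [measurable]: "level_time c s K i \<in> borel_measurable M" for i unfolding level_time_def by measurable
  have "(\<integral>\<^sup>+\<omega>. coalescence_bound c s K \<omega> \<partial>M) = (\<integral>\<^sup>+\<omega>. ennreal (1 + level_time c s K 0 \<omega>) \<partial>M) +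
     (\<Sum>i. \<integral>\<^sup>+\<omega>. ennreal (1 + level_time c s K (Suc i) \<omega>) * indicator (level_failure c s K i) \<omega> \<partial>M)"
    unfolding coalescence_bound_def by (subst nn_integral_add) (auto simp: nn_integral_suminf)
  also have "\<dots> \<le> ennreal ((3 + c) * (1 + \<mu>) * (K / s)) +
     (\<Sum>i. ennreal ((5 + 2 * c) * c2 * (K / s) * ((real i + 2)\<^sup>2 / 2 ^ i)))"
  proof (intro add_mono suminf_le)
    have "(\<integral>\<^sup>+\<omega>. ennreal (1 + level_time c s K 0 \<omega>) \<partial>M) =
       (\<integral>\<^sup>+\<omega>. ennreal (1 + level_time c s K 0 \<omega>) * indicator (space M) \<omega> \<partial>M)"
      by (intro nn_integral_cong) simp
    also have "\<dots> \<le> ennreal ((1 + (c + 2 * (0 + 1)) * (2 ^ 0 * real K / s)) * (1 + \<mu>))"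
      using c \<mu>_pos by (intro level_time_integral[where i = 0, OF small_space, unfolded of_nat_0]) auto
    also have "\<dots> \<le> ennreal ((3 + c) * (1 + \<mu>) * (K / s))"
    proof (rule ennreal_leI)
      have "(1 + (c + 2 * (0 + 1)) * (2 ^ 0 * real K / s)) \<le> (3 + c) * (K / s)"
      proof -
        have "1 + (c + 2 * (0 + 1)) * (2 ^ 0 * z) \<le> (3 + c) * z" if "1 \<le> z" for z :: real
          using that by (simp add: algebra_simps)
        from this[OF Ks] show ?thesis by simp
      qed
      hence "(1 + (c + 2 * (0 + 1)) * (2 ^ 0 * real K / s)) * (1 + \<mu>) \<le> (3 + c) * (K / s) * (1 + \<mu>)"
        using \<mu>_pos by (intro mult_right_mono) auto
      thus "(1 + (c + 2 * (0 + 1)) * (2 ^ 0 * real K / s)) * (1 + \<mu>) \<le> (3 + c) * (1 + \<mu>) * (K / s)"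
        by (simp only: mult_ac)
    qed
    finally show "(\<integral>\<^sup>+\<omega>. ennreal (1 + level_time c s K 0 \<omega>) \<partial>M) \<le> ennreal ((3 + c) * (1 + \<mu>) * (K / s))" .
  next
    fix i
    have "(\<integral>\<^sup>+\<omega>. ennreal (1 + level_time c s K (Suc i) \<omega>) * indicator (level_failure c s K i) \<omega> \<partial>M)
       \<le> ennreal ((1 + (c + 2 * (real (Suc i) + 1)) * (2 ^ Suc i * real K / s)) * (c2 * (real i + 2) / 4 ^ i))"
      using c c2 by (intro level_time_integral bad) auto
    also have "\<dots> \<le> ennreal ((5 + 2 * c) * c2 * (K / s) * ((real i + 2)\<^sup>2 / 2 ^ i))"
    proof (rule ennreal_leI)
      \<comment> \<open>Because \<open>K \<ge> s\<close>, the quantity \<open>x\<close> is at least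
        1 and absorbs the added 1, so that the bound becomes proportional to
        \<open>K / s\<close>.\<close>
      define x where "x = 2 ^ i * (K / s)"
      have "(1::real) * 1 \<le> 2 ^ i * (K / s)" using Ks by (intro mult_mono) auto
      hence x: "x \<ge> 1" by (simp add: x_def)
      have "1 + (c + 2 * (real (Suc i) + 1)) * (2 ^ Suc i * real K / s) = 1 + (2 * c + 4 * (real i + 2)) * x"
        by (simp add: x_def algebra_simps add_divide_distrib)
      also have "\<dots> \<le> (5 + 2 * c) * (real i + 2) * x"
      proof -
        have "1 + (2 * c + 4 * (real i + 2)) * x \<le> 1 * x + (2 * c + 4 * (real i + 2)) * x" using x by simp
        also have "\<dots> = (1 + 2 * c + 4 * (real i + 2)) * x" by (simp add: algebra_simps)
        also have "\<dots> \<le> (5 + 2 * c) * (real i + 2) * x"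
          using x c by (intro mult_right_mono) (auto simp: algebra_simps)
        finally show ?thesis .
      qed
      finally have "(1 + (c + 2 * (real (Suc i) + 1)) * (2 ^ Suc i * real K / s)) * (c2 * (real i + 2) / 4 ^ i)
          \<le> (5 + 2 * c) * (real i + 2) * x * (c2 * (real i + 2) / 4 ^ i)"
        using c2 by (intro mult_right_mono) auto
      also have "\<dots> = (5 + 2 * c) * c2 * (K / s) * ((real i + 2)\<^sup>2 * (2 ^ i / 4 ^ i))"
        by (simp add: x_def power2_eq_square)
      also have "2 ^ i / 4 ^ i = 1 / (2 ^ i :: real)"
        by (simp add: field_simps flip: power_mult_distrib)
      finally show "(1 + (c + 2 * (real (Suc i) + 1)) * (2 ^ Suc i * real K / s)) * (c2 * (real i + 2) / 4 ^ i)
          \<le> (5 + 2 * c) * c2 * (K / s) * ((real i + 2)\<^sup>2 / 2 ^ i)" by simp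
    qed
    finally show "(\<integral>\<^sup>+\<omega>. ennreal (1 + level_time c s K (Suc i) \<omega>) * indicator (level_failure c s K i) \<omega> \<partial>M)
       \<le> ennreal ((5 + 2 * c) * c2 * (K / s) * ((real i + 2)\<^sup>2 / 2 ^ i))" .
  qed auto
  also have "(\<Sum>i. ennreal ((5 + 2 * c) * c2 * (K / s) * ((real i + 2)\<^sup>2 / 2 ^ i)))
      = ennreal (\<Sum>i. (5 + 2 * c) * c2 * (K / s) * ((real i + 2)\<^sup>2 / 2 ^ i))"
    using c c2 by (intro suminf_ennreal2 summable_mult quadratic_over_exponential_summable) auto
  also have "(\<Sum>i. (5 + 2 * c) * c2 * (K / s) * ((real i + 2)\<^sup>2 / 2 ^ i))
      = (5 + 2 * c) * c2 * (K / s) * (\<Sum>i. (real i + 2)\<^sup>2 / 2 ^ i)"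
    by (rule suminf_mult[OF quadratic_over_exponential_summable])
  also have "ennreal ((3 + c) * (1 + \<mu>) * (K / s)) + ennreal ((5 + 2 * c) * c2 * (K / s) * (\<Sum>i. (real i + 2)\<^sup>2 / 2 ^ i))
     = ennreal ((3 + c) * (1 + \<mu>) * (K / s) + (5 + 2 * c) * c2 * (K / s) * (\<Sum>i. (real i + 2)\<^sup>2 / 2 ^ i))"
    using c c2 \<mu>_pos quadratic_over_exponential_summable
    by (intro ennreal_plus[symmetric] mult_nonneg_nonneg suminf_nonneg) auto
  finally show ?thesis by (simp add: c2_def algebra_simps)
qed

lemma coalescence_bound_eventually:
  assumes \<delta>: "\<delta> > 0"
  obtains c D s0 where "c > 0" "\<And>s K. s0 \<le> s \<Longrightarrow> 1 \<le> s \<Longrightarrow> real s powr (1 + \<delta>) \<le> real K \<Longrightarrow>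
    real K \<le> 2 * (real s)\<^sup>2 \<Longrightarrow> (\<integral>\<^sup>+\<omega>. coalescence_bound c s K \<omega> \<partial>M) \<le> ennreal (D * (K / s))"
proof -
  \<comment> \<open>This is where stability enters: \<open>c < \<mu>\<close> makes windows shorter
    than \<open>c * k\<close> rare, while \<open>\<nu> < c\<close> keeps the load below 1 even if
    customers arrive at the faster pace given by \<open>c\<close>.\<close>
  obtain c where c: "\<nu> < c" "c < \<mu>" using stable dense by blast
  have c0: "c > 0" using c \<nu>_nonneg by linarith
  obtain C where C: "C > 0"
    "\<And>h k. k \<ge> 1 \<Longrightarrow> small {\<omega>\<in>space M. window (\<lambda>j. Y j \<omega>) h k \<le> c * k} (ennreal (C / real k ^ 8))"
    "\<And>l s k. s \<ge> 1 \<Longrightarrow> real s powr (1 + \<delta>) \<le> real k \<Longrightarrow>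
       small {\<omega>\<in>space M. W l \<omega> > c * k / real s} (ennreal (C / real k ^ 8))"
    by (rule uniform_tails[OF c0 c(2) \<delta>]) blast
  obtain C' where C': "C' > 0" "\<And>s K h. s \<ge> 1 \<Longrightarrow> small {\<omega>\<in>space M.
       (\<Sum>k<K. of_bool (W (h + k) \<omega> > window (\<lambda>j. Y j \<omega>) h k / real s)) > real s} (ennreal (C' / real s ^ 6))"
    by (rule small_overload[OF c(1) C(1,2)]) blast+
  \<comment> \<open>\<open>E / s\<close> bounds the failure of one attempt; it is at most
    \<open>1 / 4\<close> as soon as \<open>s \<ge> 4 * E\<close>, hence the threshold used
    below.\<close>
  define E where "E = 3 * C + 2 * C' + 2 * C * basel"
  have E: "E > 0" using C(1) C'(1) basel_nonneg by (simp add: E_def add_pos_nonneg)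
  show ?thesis
  proof (rule that[OF c0, of "nat \<lceil>4 * E\<rceil>"])
    fix s K :: nat assume s: "nat \<lceil>4 * E\<rceil> \<le> s" "1 \<le> s"
      and K: "real s powr (1 + \<delta>) \<le> real K" "real K \<le> 2 * (real s)\<^sup>2"
    have "real s powr 1 \<le> real s powr (1 + \<delta>)" using s \<delta> by (intro powr_mono) auto
    hence sK: "s \<le> K" using K s by simp
    have serv: "small {\<omega>\<in>space M. W l \<omega> > c * k / real s} (ennreal (C / real k ^ 8))" if "k \<ge> K" for l k
    proof (rule C(3))
      show "real s powr (1 + \<delta>) \<le> real k" using K that by linarith
    qed (use s in simp)
    have fail: "emeasure M {\<omega>\<in>space M. \<not> attempt_ok c s K B n (\<lambda>j. Y j \<omega>) (\<lambda>j. W j \<omega>)} \<le> ennreal (1 / 4)" for B n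
    proof -
      have "small {\<omega>\<in>space M. \<not> attempt_ok c s K B n (\<lambda>j. Y j \<omega>) (\<lambda>j. W j \<omega>)} (ennreal (E / s))"
        unfolding E_def
      proof (rule small_attempt_failure[OF C(1) C'(1) s(2) _ sK K(2) C(2) serv C'(2)[OF s(2)]])
        show "1 \<le> K" using sK s by simp
      qed
      from small_emeasure[OF this]
      have "emeasure M {\<omega>\<in>space M. \<not> attempt_ok c s K B n (\<lambda>j. Y j \<omega>) (\<lambda>j. W j \<omega>)} \<le> ennreal (E / s)" .
      also have "\<dots> \<le> ennreal (1 / 4)"
      proof (rule ennreal_leI)
        have "4 * E \<le> s" using s by linarith
        thus "E / s \<le> 1 / 4" using s by (simp add: field_simps)
      qed
      finally show ?thesis .
    qed
    show "(\<integral>\<^sup>+\<omega>. coalescence_bound c s K \<omega> \<partial>M) \<le> ennreal (((3 + c) * (1 + \<mu>) +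
       (5 + 2 * c) * (1 + \<mu> + C + 4 * C * basel) * (\<Sum>i. (real i + 2)\<^sup>2 / 2 ^ i)) * (K / s))"
      by (rule expected_coalescence_bound[OF c0 C(1) s(2) sK C(2) serv fail])
  qed
qed

text \<open>This joins the pathwise part to the probabilistic one: at a level that does not fail,
  some attempt succeeds together with the tail condition, and its epoch lies within the range
  \<open>N\<close> of that level.\<close>

lemma abs_tauf_le_coalescence_bound:
  assumes "past A V (\<lambda>j. Y j \<omega>) (\<lambda>j. W j \<omega>) D s" and \<omega>: "\<omega> \<in> space M" and c: "c > 0" and K: "K \<ge> 1"
  shows "e2ennreal \<bar>tauf A V s\<bar> \<le> coalescence_bound c s K \<omega>"
proof (rule level_time_le_coalescence_bound[OF \<omega>])
  interpret past A V "\<lambda>j. Y j \<omega>" "\<lambda>j. W j \<omega>" D s by fact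
  fix i assume i: "\<omega> \<notin> level_failure c s K i"
  define B where "B = 2 ^ i * K"
  have B: "K \<le> B" by (simp add: B_def)
  from i \<omega> obtain b where b: "b \<le> i" "attempt_ok c s K B (2 * B * b + B) (\<lambda>j. Y j \<omega>) (\<lambda>j. W j \<omega>)"
    and t: "tail_ok c s B (2 * B * (i + 1)) (\<lambda>j. Y j \<omega>) (\<lambda>j. W j \<omega>)"
    by (auto simp: level_failure_def B_def)
  have "2 * B * b + B \<le> 2 * B * (b + 1)" by simp
  also have "\<dots> \<le> 2 * B * (i + 1)" using b(1) by (intro mult_left_mono) auto
  finally have "\<bar>tauf A V s\<bar> \<le> ereal (level_time c s K i \<omega>)"
    unfolding level_time_def B_def[symmetric] using K B c b(2) t by (intro abs_tauf_le) auto
  hence "e2ennreal \<bar>tauf A V s\<bar> \<le> e2ennreal (ereal (level_time c s K i \<omega>))" by (rule e2ennreal_mono)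
  thus "e2ennreal \<bar>tauf A V s\<bar> \<le> ennreal (level_time c s K i \<omega>)" by (simp only: e2ennreal_ereal)
qed (use c in simp)

end

section \<open>Transfer to the stationary queue\<close>

lemma (in prob_space) indep_vars_reindex_real:
  assumes ind: "indep_vars (\<lambda>_. borel) Z I" and f: "inj f" "range f \<subseteq> I"
    and g: "g \<in> borel_measurable borel"
  shows "indep_vars (\<lambda>_. borel) (\<lambda>i \<omega>. g (Z (f i) \<omega> :: real) :: real) UNIV"
proof -
  have "indep_vars (\<lambda>i. PiM {f i} (\<lambda>_. borel)) (\<lambda>i \<omega>. restrict (\<lambda>k. Z k \<omega>) {f i}) UNIV"
    using f by (intro indep_vars_restrict[OF ind]) (auto simp: disjoint_family_on_def inj_def)
  hence "indep_vars (\<lambda>_. borel) (\<lambda>i \<omega>. g (restrict (\<lambda>k. Z k \<omega>) {f i} (f i))) UNIV"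
    by (rule indep_vars_compose2) (rule measurable_compose[OF _ g], simp)
  thus ?thesis by simp
qed

lemma arr_past: "arr s g l u (- int n) = - ((1 - u) * l / s) - (\<Sum>j<n. g (- int (Suc j))) / s"
proof -
  have "(\<Sum>j\<in>{- int n..-1}. g j) = (\<Sum>j<n. g (- int (Suc j)))"
    by (rule sum.reindex_bij_witness[of _ "\<lambda>j. - int (Suc j)" "\<lambda>j. nat (- j - 1)"]) auto
  thus ?thesis by (simp add: arr_def diff_divide_distrib left_diff_distrib)
qed

lemma arr_future:
  assumes "k \<ge> 1" "s \<ge> 0" "u \<ge> 0" "l \<ge> 0" "\<And>j. j \<noteq> 0 \<Longrightarrow> g j \<ge> 0"
  shows "arr s g l u k \<ge> 0"
  using assms by (auto simp: arr_def intro!: add_nonneg_nonneg divide_nonneg_nonneg sum_nonneg)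

theorem theorem2:
  fixes M :: "'a measure" and X V :: "int \<Rightarrow> 'a \<Rightarrow> real" and L U :: "'a \<Rightarrow> real"
    and F :: "real \<Rightarrow> real" and \<delta> :: real
  assumes "prob_space M"
    and "prob_space.indep_vars M (\<lambda>_. borel) (srcvar X V L U) (UNIV - {Gap 0})"
    and "\<forall>k. k \<noteq> 0 \<longrightarrow> distr M borel (X k) = distr M borel (X 1)"
    and "\<forall>k. distr M borel (V k) = distr M borel (V 1)"
    and "AE \<omega> in M. X 1 \<omega> > 0"
    and "integrable M (X 1)"
    and "nonlattice (distr M borel (X 1))"
    and "\<forall>k. AE \<omega> in M. V k \<omega> \<ge> 0"
    and "\<forall>q>0. integrable M (\<lambda>\<omega>. V 1 \<omega> powr q)"
    and "cdf (distr M borel (V 1)) = F"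
    and "continuous_on UNIV F"
    and "distr M borel L = density (distr M borel (X 1)) (\<lambda>x. ennreal (x / integral\<^sup>L M (X 1)))"
    and "distr M borel U = uniform_measure lborel {0..1}"
    and "integral\<^sup>L M (V 1) / integral\<^sup>L M (X 1) < 1"
    and "\<delta> > 0"
  shows "\<forall>\<epsilon>>0. eventually (\<lambda>s::nat.
           (\<integral>\<^sup>+\<omega>. e2ennreal \<bar>tauf (arr (real s) (\<lambda>j. X j \<omega>) (L \<omega>) (U \<omega>)) (\<lambda>k. V k \<omega>) s\<bar> \<partial>M)
             \<le> ennreal (\<epsilon> * real s powr \<delta>)) sequentially"
proof -
  interpret prob_space M by fact
  note ind = assms(2)
  have src: "srcvar X V L U i \<in> borel_measurable M" if "i \<noteq> Gap 0" for i
    using ind that by (auto simp: indep_vars_def)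
  have X_meas: "X k \<in> borel_measurable M" if "k \<noteq> 0" for k
    using src[of "Gap k"] that by (simp add: srcvar_def)
  have V_meas[measurable]: "V k \<in> borel_measurable M" for k
    using src[of "Serv k"] by (simp add: srcvar_def)
  have L_meas[measurable]: "L \<in> borel_measurable M" using src[of LenB] by (simp add: srcvar_def)
  have U_meas[measurable]: "U \<in> borel_measurable M" using src[of Unif] by (simp add: srcvar_def)
  have [measurable]: "X 1 \<in> borel_measurable M" by (rule X_meas) simp
  have X_distr: "distr M borel (X k) = distr M borel (X 1)" if "k \<noteq> 0" for k
    using assms(3) that by blast
  have V_distr: "distr M borel (V k) = distr M borel (V 1)" for k using assms(4) by blast

  have X_pos: "AE \<omega> in M. X k \<omega> > 0" if "k \<noteq> 0" for k
  proof -
    have "AE x in distr M borel (X k). x > 0"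
      unfolding X_distr[OF that] using assms(5) by (subst AE_distr_iff) auto
    thus ?thesis using X_meas[OF that] by (subst (asm) AE_distr_iff) auto
  qed
  have L_nonneg: "AE \<omega> in M. L \<omega> \<ge> 0"
  proof -
    have "AE x in distr M borel (X 1). x > 0" using assms(5) by (subst AE_distr_iff) auto
    hence "AE x in distr M borel L. x \<ge> 0"
      unfolding assms(12) by (subst AE_density) (auto elim!: AE_mp)
    thus ?thesis by (subst (asm) AE_distr_iff) auto
  qed
  have U_range: "AE \<omega> in M. 0 \<le> U \<omega> \<and> U \<omega> \<le> 1"
  proof -
    have "AE x in distr M borel U. 0 \<le> x \<and> x \<le> 1"
      unfolding assms(13) by (rule AE_uniform_measureI) auto
    thus ?thesis by (subst (asm) AE_distr_iff) auto
  qed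

  \<comment> \<open>Index 0 belongs to the length-biased interval, so the gap between customers
    \<open>j + 1\<close> and \<open>j\<close> is \<open>X (- (j + 1))\<close>; hence the shift.
    Clipping at 0 changes the variables only on a null set and makes signs hold everywhere.\<close>
  define Y where "Y j \<omega> = max 0 (X (- int (Suc j)) \<omega>)" for j \<omega>
  define W where "W j \<omega> = max 0 (V (- int j) \<omega>)" for j \<omega>
  have clip_distr: "distr M borel (\<lambda>\<omega>. max 0 (f \<omega>)) = distr (distr M borel f) borel (max 0)"
    if "f \<in> borel_measurable M" for f :: "'a \<Rightarrow> real"
    using that by (subst distr_distr) (auto simp: comp_def)
  have Y_eq: "Y j = (\<lambda>\<omega>. max 0 (X (- int (Suc j)) \<omega>))" for j by (simp add: Y_def fun_eq_iff)
  have W_eq: "W j = (\<lambda>\<omega>. max 0 (V (- int j) \<omega>))" for j by (simp add: W_def fun_eq_iff)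
  have Y_distr: "distr M borel (Y j) = distr M borel (\<lambda>\<omega>. max 0 (X 1 \<omega>))" for j
  proof -
    have k: "- int (Suc j) \<noteq> 0" by simp
    show ?thesis unfolding Y_eq clip_distr[OF X_meas[OF k]] X_distr[OF k] by (rule clip_distr[symmetric]) measurable
  qed
  have W_distr: "distr M borel (W j) = distr M borel (\<lambda>\<omega>. max 0 (V 1 \<omega>))" for j
    unfolding W_eq clip_distr[OF V_meas] V_distr[of "- int j"] ..
  have Y_meas[measurable]: "Y j \<in> borel_measurable M" for j
    unfolding Y_eq by (intro borel_measurable_max X_meas) auto
  have W_meas[measurable]: "W j \<in> borel_measurable M" for j unfolding W_eq by measurable
  have clipX_meas: "(\<lambda>\<omega>. max 0 (X 1 \<omega>)) \<in> borel_measurable M"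
    and clipV_meas: "(\<lambda>\<omega>. max 0 (V 1 \<omega>)) \<in> borel_measurable M" by measurable
  have clipX: "AE \<omega> in M. max 0 (X 1 \<omega>) = X 1 \<omega>" using assms(5) by (auto elim!: AE_mp)
  have V1: "AE \<omega> in M. V 1 \<omega> \<ge> 0" using assms(8) by blast
  have clipV: "AE \<omega> in M. max 0 (V 1 \<omega>) = V 1 \<omega>" using V1 by (auto elim!: AE_mp)
  have transfer_integrable: "integrable M (\<lambda>\<omega>. g (f \<omega>)) \<longleftrightarrow> integrable M (\<lambda>\<omega>. g (f' \<omega>))"
    and transfer_integral: "(\<integral>\<omega>. g (f \<omega>) \<partial>M) = (\<integral>\<omega>. g (f' \<omega>) \<partial>M)"
    if "distr M borel f = distr M borel f'" "f \<in> borel_measurable M" "f' \<in> borel_measurable M"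
      "g \<in> borel_measurable borel" for f f' :: "'a \<Rightarrow> real" and g :: "real \<Rightarrow> real"
    using that integrable_distr_eq[of f M borel g] integrable_distr_eq[of f' M borel g]
      integral_distr[of f M borel g] integral_distr[of f' M borel g] by simp_all
  have EY: "integrable M (Y 0)" "expectation (Y 0) = expectation (X 1)"
  proof -
    have "integrable M (\<lambda>\<omega>. max 0 (X 1 \<omega>)) \<longleftrightarrow> integrable M (X 1)"
      using clipX by (intro integrable_cong_AE) auto
    thus "integrable M (Y 0)"
      using assms(6) transfer_integrable[OF Y_distr[of 0] Y_meas clipX_meas measurable_ident_sets[OF refl]]
      by (simp only: id_apply)
    have "expectation (\<lambda>\<omega>. max 0 (X 1 \<omega>)) = expectation (X 1)"
      using clipX by (intro integral_cong_AE) auto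
    thus "expectation (Y 0) = expectation (X 1)"
      using transfer_integral[OF Y_distr[of 0] Y_meas clipX_meas measurable_ident_sets[OF refl]]
      by (simp only: id_apply)
  qed
  have EW: "expectation (W 0) = expectation (V 1)"
  proof -
    have "expectation (\<lambda>\<omega>. max 0 (V 1 \<omega>)) = expectation (V 1)"
      using clipV by (intro integral_cong_AE) auto
    thus ?thesis using transfer_integral[OF W_distr[of 0] W_meas clipV_meas measurable_ident_sets[OF refl]]
      by (simp only: id_apply)
  qed
  have W_int: "integrable M (\<lambda>\<omega>. W 0 \<omega> powr q)" if "q > 0" for q
  proof -
    have "integrable M (\<lambda>\<omega>. max 0 (V 1 \<omega>) powr q) \<longleftrightarrow> integrable M (\<lambda>\<omega>. V 1 \<omega> powr q)"
      using V1 by (intro integrable_cong_AE) (auto elim!: AE_mp)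
    moreover have "(\<lambda>x. x powr q) \<in> borel_measurable (borel :: real measure)" by measurable
    note transfer_integrable[OF W_distr[of 0] W_meas clipV_meas this]
    ultimately show ?thesis using assms(9) that by (simp only:)
  qed
  \<comment> \<open>As \<open>x / 0 = 0\<close>, the condition on the quotient gives
    \<open>E V < E X\<close> only once the denominator is known to be positive.\<close>
  have \<mu>_pos: "expectation (X 1) > 0"
  proof -
    have "expectation (X 1) \<noteq> 0"
    proof
      assume "expectation (X 1) = 0"
      hence "AE \<omega> in M. X 1 \<omega> = 0"
        using assms(5,6) by (subst (asm) integral_nonneg_eq_0_iff_AE) (auto elim!: AE_mp)
      hence "AE \<omega> in M. False" using assms(5) by eventually_elim simp
      thus False by (simp add: AE_False)
    qed
    moreover have "expectation (X 1) \<ge> 0"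
      using assms(5) by (intro integral_nonneg_AE) (auto elim!: AE_mp)
    ultimately show ?thesis by simp
  qed

  interpret iid_queue M Y W
  proof
    let ?f = "\<lambda>i. case i of Inl j \<Rightarrow> Gap (- int (Suc j)) | Inr j \<Rightarrow> Serv (- int j)"
    have "indep_vars (\<lambda>_. borel) (\<lambda>i \<omega>. max 0 (srcvar X V L U (?f i) \<omega>)) UNIV"
      by (rule indep_vars_reindex_real[OF ind]) (auto simp: inj_def split: sum.splits)
    also have "(\<lambda>i \<omega>. max 0 (srcvar X V L U (?f i) \<omega>)) = case_sum Y W"
      by (auto simp: fun_eq_iff srcvar_def Y_def W_def split: sum.splits)
    finally show "indep_vars (\<lambda>_. borel) (case_sum Y W) UNIV" .
    show "distr M borel (Y j) = distr M borel (Y 0)" for j by (simp only: Y_distr)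
    show "distr M borel (W j) = distr M borel (W 0)" for j by (simp only: W_distr)
    show "expectation (W 0) < expectation (Y 0)" using assms(14) \<mu>_pos by (simp add: EY EW)
  qed (use EY W_int in \<open>auto simp: Y_def W_def\<close>)

  \<comment> \<open>\<open>d < \<delta>\<close> leaves a factor \<open>s powr (\<delta> - d)\<close>
    to outgrow the constant; \<open>d \<le> 1\<close> ensures that \<open>K\<close> is at most
    \<open>2 s^2\<close>.\<close>
  define d where "d = min (\<delta> / 2) 1"
  have d: "0 < d" "d \<le> 1" "d < \<delta>" using assms(15) by (auto simp: d_def)
  obtain c D s0 where c: "c > 0" and D: "\<And>s K. s0 \<le> s \<Longrightarrow> 1 \<le> s \<Longrightarrow> real s powr (1 + d) \<le> real K \<Longrightarrow>
    real K \<le> 2 * (real s)\<^sup>2 \<Longrightarrow> (\<integral>\<^sup>+\<omega>. coalescence_bound c s K \<omega> \<partial>M) \<le> ennreal (D * (K / s))"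
    by (rule coalescence_bound_eventually[OF d(1)]) blast
  have bound: "(\<integral>\<^sup>+\<omega>. e2ennreal \<bar>tauf (arr (real s) (\<lambda>j. X j \<omega>) (L \<omega>) (U \<omega>)) (\<lambda>k. V k \<omega>) s\<bar> \<partial>M)
      \<le> ennreal (2 * \<bar>D\<bar> * real s powr d)" if s: "s0 \<le> s" "1 \<le> s" for s
  proof -
    define K where "K = nat \<lceil>real s powr (1 + d)\<rceil>"
    \<comment> \<open>Rounding up a real number that is at least 1 at most doubles it, which gives
      the upper bound on \<open>K\<close>.\<close>
    have p1: "1 \<le> real s powr (1 + d)" using s d by (intro ge_one_powr_ge_zero) auto
    have K: "real s powr (1 + d) \<le> real K" "real K \<le> 2 * real s powr (1 + d)"
      using p1 unfolding K_def by linarith+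
    have "real s powr (1 + d) \<le> real s powr 2" using s d by (intro powr_mono) auto
    hence K2: "real K \<le> 2 * (real s)\<^sup>2" using K s by (simp add: powr_numeral)
    have K1: "K \<ge> 1" using K p1 by linarith
    have "AE \<omega> in M. \<forall>k. k \<noteq> 0 \<longrightarrow> X k \<omega> > 0"
      unfolding AE_all_countable using X_pos by auto
    moreover have "AE \<omega> in M. \<forall>k. V k \<omega> \<ge> 0" unfolding AE_all_countable using assms(8) by auto
    ultimately have "AE \<omega> in M. e2ennreal \<bar>tauf (arr (real s) (\<lambda>j. X j \<omega>) (L \<omega>) (U \<omega>)) (\<lambda>k. V k \<omega>) s\<bar>
        \<le> coalescence_bound c s K \<omega>"
      using L_nonneg U_range AE_space
    proof eventually_elim
      case (elim \<omega>)
      have "past (arr (real s) (\<lambda>j. X j \<omega>) (L \<omega>) (U \<omega>)) (\<lambda>k. V k \<omega>)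
         (\<lambda>j. Y j \<omega>) (\<lambda>j. W j \<omega>) ((1 - U \<omega>) * L \<omega> / real s) s"
      proof
        show "arr (real s) (\<lambda>j. X j \<omega>) (L \<omega>) (U \<omega>) (- int n) =
          - ((1 - U \<omega>) * L \<omega> / real s) - sum (\<lambda>j. Y j \<omega>) {..<n} / real s" for n
        proof -
          have "Y j \<omega> = X (- int (Suc j)) \<omega>" for j
            using elim(1) by (auto simp: Y_def max_def intro: order_less_imp_le)
          thus ?thesis by (simp only: arr_past)
        qed
        show "0 \<le> arr (real s) (\<lambda>j. X j \<omega>) (L \<omega>) (U \<omega>) k" if "k \<ge> 1" for k
          using that elim by (intro arr_future) (auto intro: order_less_imp_le)
        show "V (- int n) \<omega> = W n \<omega>" for n using elim(2) by (simp add: W_def)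
      qed (use s elim Y_nonneg W_nonneg in auto)
      thus ?case using elim c K1 by (intro abs_tauf_le_coalescence_bound)
    qed
    hence "(\<integral>\<^sup>+\<omega>. e2ennreal \<bar>tauf (arr (real s) (\<lambda>j. X j \<omega>) (L \<omega>) (U \<omega>)) (\<lambda>k. V k \<omega>) s\<bar> \<partial>M)
        \<le> (\<integral>\<^sup>+\<omega>. coalescence_bound c s K \<omega> \<partial>M)" by (rule nn_integral_mono_AE)
    also have "\<dots> \<le> ennreal (D * (K / s))" by (rule D[OF s K(1) K2])
    also have "\<dots> \<le> ennreal (2 * \<bar>D\<bar> * real s powr d)"
    proof (rule ennreal_leI)
      have "D * (K / s) \<le> \<bar>D\<bar> * (2 * real s powr (1 + d) / s)"
        using K by (intro mult_mono divide_right_mono) auto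
      also have "\<dots> = 2 * \<bar>D\<bar> * real s powr d" using s by (simp add: powr_add)
      finally show "D * (K / s) \<le> 2 * \<bar>D\<bar> * real s powr d" .
    qed
    finally show ?thesis .
  qed
  show ?thesis
  proof (intro allI impI)
    fix \<epsilon> :: real assume \<epsilon>: "\<epsilon> > 0"
    define b where "b = 2 * \<bar>D\<bar> / \<epsilon>"
    have b: "b \<ge> 0" using \<epsilon> by (simp add: b_def)
    have "eventually (\<lambda>s::nat. real s powr (\<delta> - d) \<ge> b) sequentially"
      using eventually_ge_at_top[of "nat \<lceil>b powr (1 / (\<delta> - d))\<rceil>"]
    proof eventually_elim
      case (elim s)
      hence "(b powr (1 / (\<delta> - d))) powr (\<delta> - d) \<le> real s powr (\<delta> - d)"
        using d by (intro powr_mono2) auto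
      thus ?case using b d by (cases "b = 0") (simp_all add: powr_powr)
    qed
    thus "eventually (\<lambda>s::nat.
           (\<integral>\<^sup>+\<omega>. e2ennreal \<bar>tauf (arr (real s) (\<lambda>j. X j \<omega>) (L \<omega>) (U \<omega>)) (\<lambda>k. V k \<omega>) s\<bar> \<partial>M)
             \<le> ennreal (\<epsilon> * real s powr \<delta>)) sequentially"
      using eventually_ge_at_top[of s0] eventually_ge_at_top[of 1]
    proof eventually_elim
      case (elim s)
      have "2 * \<bar>D\<bar> \<le> \<epsilon> * real s powr (\<delta> - d)" using elim(1) \<epsilon> by (simp add: b_def field_simps)
      hence "2 * \<bar>D\<bar> * real s powr d \<le> \<epsilon> * real s powr (\<delta> - d) * real s powr d"
        by (intro mult_right_mono) auto
      also have "\<dots> = \<epsilon> * real s powr \<delta>" by (simp add: mult.assoc flip: powr_add)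
      finally show ?case using bound[OF elim(2,3)] by (meson ennreal_leI order_trans)
    qed
  qed
qed

end
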